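(* Let $\alpha>0$, let $F$ be a continuous distribution function of a positive random variable $X$ with $m(\alpha)=E(X^\alpha)<\infty$, and let $R(x)=\sum_{n=0}^{\infty}F^{\boxtimes n}(x)$ be the Kendall renewal function of $F$. If $\overline{F}\in\Gamma(g)$, then $$\lim_{x\to\infty}\frac{1}{x^{\alpha}\overline{F}(x)}\left(\frac{2}{m(\alpha)}-x^{-\alpha}R(x)\right)=\frac{1}{m^{2}(\alpha)},$$ and, as $x\to\infty$, $$\frac{1}{x^{\alpha}\overline{F}(x)}\left(x^{-\alpha}R(x)-\frac{2}{m(\alpha)}\right)+\frac{1}{m^{2}(\alpha)}\sim\frac{g(x)}{x}\,\frac{2\alpha}{m^{2}(\alpha)}.$$
   Context: Fix $\alpha>0$. $X$ is a positive random variable with distribution function $F(x)=P(X\le x)$, $F(0-)=0$, $F$ continuous; $\overline{F}=1-F$; $m(\alpha)=\int_0^\infty y^\alpha\,dF(y)$; $m^2(\alpha)$ means $(m(\alpha))^2$. The Williamson transform ($G$-transform) of a distribution function $F$ with $F(0-)=0$ is $G_F(x)=\int_0^x\bigl(1-(t/x)^\alpha\bigr)\,dF(t)$, $x>0$. The Kendall convolution $F_1\boxtimes F_2$ of two distribution functions with $F_i(0-)=0$ is the distribution function $F_3$ (with $F_3(0-)=0$) determined by $G_{F_3}(x)=G_{F_1}(x)G_{F_2}(x)$. The $n$-fold Kendall convolution $F^{\boxtimes n}$ is thus the distribution function with $G$-transform $G_F^n$, and $F^{\boxtimes 0}$ is the distribution function of the point mass at $0$. A positive measurable function $f$ is in the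 class $\Gamma(g)$ with (positive, measurable) auxiliary function $g$ if $\lim_{x\to\infty}f(x+tg(x))/f(x)=e^{-t}$ for all real $t$; here $g$ is self-neglecting, i.e. $\lim_{x\to\infty}g(x+tg(x))/g(x)=1$ for all real $t$, and satisfies $\lim_{x\to\infty}g(x)/x=0$. The notation $a(x)\sim b(x)$ means $a(x)/b(x)\to1$ as $x\to\infty$. *)

theory Defs
  imports "HOL-Probability.Probability" "HOL-Library.Landau_Symbols"
begin

definition dist_fun_nonneg :: "(real \<Rightarrow> real) \<Rightarrow> bool" where
  "dist_fun_nonneg F \<longleftrightarrow>
     mono F \<and> (\<forall>x. continuous (at_right x) F) \<and> (\<forall>x<0. F x = 0) \<and> (F \<longlongrightarrow> 1) at_top"

text \<open>The closed interval includes the point 0, so that a possible atom at 0 is counted;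
  in particular the point mass at 0 has transform 1.\<close>

definition williamson :: "real \<Rightarrow> (real \<Rightarrow> real) \<Rightarrow> real \<Rightarrow> real" where
  "williamson \<alpha> F x = (LINT t:{0..x}|interval_measure F. 1 - (t / x) powr \<alpha>)"

definition kendall_conv ::
  "real \<Rightarrow> (real \<Rightarrow> real) \<Rightarrow> (real \<Rightarrow> real) \<Rightarrow> real \<Rightarrow> real" where
  "kendall_conv \<alpha> F1 F2 =
     (THE F3. dist_fun_nonneg F3 \<and>
        (\<forall>x>0. williamson \<alpha> F3 x = williamson \<alpha> F1 x * williamson \<alpha> F2 x))"

primrec kendall_power :: "real \<Rightarrow> (real \<Rightarrow> real) \<Rightarrow> nat \<Rightarrow> real \<Rightarrow> real" where
  "kendall_power \<alpha> F 0 = cdf (return borel 0)"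
| "kendall_power \<alpha> F (Suc n) = kendall_conv \<alpha> (kendall_power \<alpha> F n) F"

definition kendall_renewal :: "real \<Rightarrow> (real \<Rightarrow> real) \<Rightarrow> real \<Rightarrow> real" where
  "kendall_renewal \<alpha> F x = (\<Sum>n. kendall_power \<alpha> F n x)"

definition self_neglecting :: "(real \<Rightarrow> real) \<Rightarrow> bool" where
  "self_neglecting g \<longleftrightarrow> (\<forall>t. ((\<lambda>x. g (x + t * g x) / g x) \<longlongrightarrow> 1) at_top)"

text \<open>Positivity and measurability are only required on the positive half-line, where the
  auxiliary functions are naturally defined (for instance \<open>g x = 1 / x\<close>).\<close>

definition pos_measurable :: "(real \<Rightarrow> real) \<Rightarrow> bool" where
  "pos_measurable f \<longleftrightarrow> (\<forall>x>0. f x > 0) \<and> set_borel_measurable borel {0<..} f"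

definition class_Gamma :: "(real \<Rightarrow> real) \<Rightarrow> (real \<Rightarrow> real) set" where
  "class_Gamma g =
     {f. pos_measurable f \<and> pos_measurable g \<and>
         self_neglecting g \<and> ((\<lambda>x. g x / x) \<longlongrightarrow> 0) at_top \<and>
         (\<forall>t. ((\<lambda>x. f (x + t * g x) / f x) \<longlongrightarrow> exp (- t)) at_top)}"

end

theory Submission imports Defs begin

text \<open>
  Write \<open>G\<close> for the transform of \<open>F\<close>. The whole argument rests on an exact formula for the
  renewal function. The function \<open>W x = x powr \<alpha> * G x\<close> is convex in the variable \<open>x powr \<alpha>\<close>, and
  \<open>F x\<close> is its right derivative there. Differentiating \<open>x powr \<alpha> * G1 x * G2 x\<close> in this
  variable therefore gives the Kendall convolution in closed form,
  \<open>F1 * G2 + F2 * G1 - G1 * G2\<close>, and by induction the \<open>n\<close>-th Kendall power of \<open>F\<close> is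
  \<open>G ^ n + n * G ^ (n - 1) * (F - G)\<close>. Summing a geometric series and its derivative yields
  \<open>R = 2 / (1 - G) - (1 - F) / (1 - G)^2\<close> (lemma \<open>kendall_renewal_eq\<close>). The convolution is
  defined by a description operator, so existence and uniqueness have to be proved as well. No
  derivative or integral over the line is used for this: convexity and the derivative are replaced
  by the subgradient inequality \<open>subgradient_pair\<close>, which determines \<open>G\<close> from \<open>F\<close> and, by right
  continuity, \<open>F\<close> from \<open>G\<close>, and which is preserved by products of transforms.

  Probabilistically, \<open>x powr \<alpha> * (1 - G x) = E (min X x) powr \<alpha> = m - \<delta> x\<close>, where
  \<open>\<delta> x\<close> is the mean excess of \<open>X powr \<alpha>\<close> over \<open>x powr \<alpha>\<close>. So
  \<open>x powr (-\<alpha>) * R x = 2 / (m - \<delta> x) - Q x / (m - \<delta> x)^2\<close> with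
  \<open>Q x = x powr \<alpha> * (1 - F x)\<close>, and both \<open>\<delta>\<close> and \<open>Q\<close> tend to 0 because the moment
  is finite. After division by \<open>Q x\<close> both claims follow from \<open>\<delta> x / Q x \<sim> \<alpha> * g x / x\<close>
  (lemma \<open>excess_asymp\<close>): the second differs from \<open>2 * \<delta> x / (m^2 * Q x)\<close> only by terms of
  smaller order, among them a multiple of \<open>\<delta> x\<close> itself.

  This last asymptotic is where the limit relations defining the class \<open>\<Gamma>\<close> enter. In place
  of a dominated convergence argument, its proof compares \<open>\<delta>\<close> with a multiple of
  \<open>A x = x powr (\<alpha> - 1) * g x * (1 - F x)\<close> along the orbit of the map \<open>x \<mapsto> x + t * g x\<close>. One
  step of this map multiplies \<open>A\<close> by about \<open>exp (-t)\<close> and decreases \<open>\<delta>\<close> by an amount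
  between about \<open>\<alpha> * t * exp (-t) * A x\<close> and \<open>\<alpha> * t * A x\<close>. If \<open>k > \<alpha>\<close>, then for small
  \<open>t\<close> the difference \<open>\<delta> - k * A\<close> increases along the orbit, and since it tends to 0 it is
  nowhere positive far out; symmetrically for \<open>k < \<alpha>\<close>.
\<close>

section \<open>Transforms and the subgradient inequality\<close>

text \<open>
  Cutting \<open>[0, v]\<close> into \<open>n\<close> equal pieces, the bounds on the increments of \<open>D\<close> telescope to
  \<open>v / n * (K v - K 0)\<close>, and \<open>n\<close> is arbitrary. This is what makes a convex function unique once
  its subgradients \<open>K\<close> are known, at jumps of \<open>K\<close> too.
\<close>

lemma const_if_increment_le_mesh:
  fixes D K :: "real \<Rightarrow> real"
  assumes D: "\<And>u v. 0 \<le> u \<Longrightarrow> u \<le> v \<Longrightarrow> \<bar>D v - D u\<bar> \<le> (v - u) * (K v - K u)"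
    and "0 \<le> v"
  shows "D v = D 0"
proof -
  have bound: "\<bar>D v - D 0\<bar> \<le> (v * (K v - K 0)) * inverse (real (Suc n))" for n
  proof -
    define p where "p i = real i * (v / real (Suc n))" for i
    have step: "p (Suc i) - p i = v / real (Suc n)" for i
      unfolding p_def left_diff_distrib[symmetric] by simp
    have p: "0 \<le> p i" "p i \<le> p (Suc i)" for i
    proof -
      show "0 \<le> p i" using \<open>0 \<le> v\<close> by (simp add: p_def)
      have "0 \<le> v / real (Suc n)" using \<open>0 \<le> v\<close> by simp
      then show "p i \<le> p (Suc i)" using step[of i] by linarith
    qed
    have "D v - D 0 = (\<Sum>i<Suc n. D (p (Suc i)) - D (p i))"
      by (subst sum_lessThan_telescope) (simp add: p_def)
    also have "\<bar>\<dots>\<bar> \<le> (\<Sum>i<Suc n. \<bar>D (p (Suc i)) - D (p i)\<bar>)"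
      by (rule sum_abs)
    also have "\<dots> \<le> (\<Sum>i<Suc n. v / real (Suc n) * (K (p (Suc i)) - K (p i)))"
      by (intro sum_mono) (use D p step in metis)
    also have "\<dots> = v / real (Suc n) * (K v - K 0)"
      by (subst sum_distrib_left[symmetric], subst sum_lessThan_telescope) (simp add: p_def)
    finally show ?thesis
      by (simp add: field_simps)
  qed
  have "(\<lambda>n. (v * (K v - K 0)) * inverse (real (Suc n))) \<longlonglongrightarrow> (v * (K v - K 0)) * 0"
    by (intro tendsto_mult tendsto_const LIMSEQ_inverse_real_of_nat)
  then have "\<bar>D v - D 0\<bar> \<le> (v * (K v - K 0)) * 0"
    by (rule LIMSEQ_le_const) (use bound in blast)
  then show ?thesis by simp
qed

text \<open>
  In the variable \<open>u = x powr \<alpha>\<close> the inequality says that \<open>F\<close> supplies a subgradient, at every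
  point of the half-line, of the function \<open>u * G\<close>; this function is then automatically convex.
  The two directions \<open>x < y\<close> and \<open>y < x\<close> sandwich the difference quotients of \<open>u * G\<close>
  between values of \<open>F\<close>. The value at 0 is prescribed separately because the factor
  \<open>x powr \<alpha>\<close> hides it.
\<close>

definition subgradient_pair :: "real \<Rightarrow> (real \<Rightarrow> real) \<Rightarrow> (real \<Rightarrow> real) \<Rightarrow> bool" where
  "subgradient_pair \<alpha> F G \<longleftrightarrow> G 0 = F 0 \<and>
     (\<forall>x\<ge>0. \<forall>y\<ge>0. x powr \<alpha> * G x + F x * (y powr \<alpha> - x powr \<alpha>) \<le> y powr \<alpha> * G y)"

lemma subgradient_pairD:
  assumes "subgradient_pair \<alpha> F G" "0 \<le> x" "0 \<le> y"
  shows "x powr \<alpha> * G x + F x * (y powr \<alpha> - x powr \<alpha>) \<le> y powr \<alpha> * G y"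
  using assms by (auto simp: subgradient_pair_def)

lemma dist_fun_nonneg_real_distribution:
  assumes "dist_fun_nonneg F"
  shows "real_distribution (interval_measure F)" "cdf (interval_measure F) = F"
proof -
  have bot: "(F \<longlongrightarrow> 0) at_bot"
    using assms unfolding dist_fun_nonneg_def
    by (intro tendsto_eventually eventually_at_bot_linorderI[of "-1"]) auto
  show "real_distribution (interval_measure F)" "cdf (interval_measure F) = F"
    using assms bot unfolding dist_fun_nonneg_def mono_def
    by (auto intro!: real_distribution_interval_measure cdf_interval_measure)
qed

text \<open>
  The assumption forces the left limit of the distribution function at 0 to vanish, but an atom at
  0 may be present, and the closed interval counts it.
\<close>

lemma (in real_distribution) measure_Icc_eq_cdf:
  assumes "\<And>x. x < 0 \<Longrightarrow> cdf M x = 0" "0 \<le> x"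
  shows "measure M {0..x} = cdf M x"
proof -
  have "(cdf M \<longlongrightarrow> 0) (at_left 0)"
    using assms(1) by (intro tendsto_eventually) (auto simp: eventually_at_filter)
  then have "measure M {..<0} = 0"
    using cdf_at_left[of 0] tendsto_unique trivial_limit_at_left_real by blast
  moreover have "measure M ({..<0} \<union> {0..x}) = measure M {..<0} + measure M {0..x}"
    by (intro finite_measure_Union) auto
  moreover have "{..<0} \<union> {0..x} = {..x}" using assms(2) by auto
  ultimately show ?thesis by (simp add: cdf_def)
qed

text \<open>
  For \<open>y = 0\<close> both sides vanish, even if there is an atom at 0: the interval on the right
  consists of the single point 0, where the integrand is 0.
\<close>

lemma scaled_williamson:
  assumes "\<alpha> > 0" "0 \<le> y"
  shows "y powr \<alpha> * williamson \<alpha> F y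
    = (LINT t:{0..y}|interval_measure F. y powr \<alpha> - t powr \<alpha>)"
proof (cases "y = 0")
  case True
  have "(LINT t:{0..0}|interval_measure F. 0 powr \<alpha> - t powr \<alpha>)
      = (LINT t|interval_measure F. 0)"
    unfolding set_lebesgue_integral_def
    by (intro Bochner_Integration.integral_cong) (auto simp: indicator_def)
  then show ?thesis using True by simp
next
  case False
  have scale: "y powr \<alpha> * (indicator {0..y} t *\<^sub>R (1 - (t / y) powr \<alpha>))
      = indicator {0..y} t *\<^sub>R (y powr \<alpha> - t powr \<alpha>)" for t
    using False assms by (auto simp: indicator_def powr_divide field_simps)
  then show ?thesis
    unfolding williamson_def set_lebesgue_integral_def
    by (subst integral_mult_right_zero[symmetric]) (simp only: scale)
qed

text \<open>
  The left-hand side of the subgradient inequality is the integral of \<open>y powr \<alpha> - t powr \<alpha>\<close> over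
  \<open>t \<in> {0..x}\<close>. The integrand is nonnegative exactly for \<open>t \<le> y\<close>, so among all \<open>x\<close> the
  integral is largest at \<open>x = y\<close>, where it is the right-hand side.
\<close>

lemma subgradient_pair_williamson:
  assumes "\<alpha> > 0" and F: "dist_fun_nonneg F"
  shows "subgradient_pair \<alpha> F (williamson \<alpha> F)"
proof -
  let ?\<mu> = "interval_measure F"
  interpret real_distribution ?\<mu>
    using dist_fun_nonneg_real_distribution[OF F] by simp
  have mass: "measure ?\<mu> {0..x} = F x" if "0 \<le> x" for x
    using measure_Icc_eq_cdf[OF _ that] F dist_fun_nonneg_real_distribution(2)[OF F]
    by (simp add: dist_fun_nonneg_def)
  have int: "set_integrable ?\<mu> {0..x} (\<lambda>t. y powr \<alpha> - t powr \<alpha>)" for x y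
    unfolding set_integrable_def
  proof (rule integrable_const_bound[where B="y powr \<alpha> + x powr \<alpha>"])
    show "AE t in ?\<mu>. norm (indicator {0..x} t *\<^sub>R (y powr \<alpha> - t powr \<alpha>)) \<le> y powr \<alpha> + x powr \<alpha>"
    proof (rule AE_I2)
      fix t :: real
      have "t powr \<alpha> \<le> x powr \<alpha>" if "0 \<le> t" "t \<le> x"
        using that \<open>\<alpha> > 0\<close> by (intro powr_mono2) auto
      moreover have "0 \<le> t powr \<alpha>" "0 \<le> y powr \<alpha>" by simp_all
      ultimately show "norm (indicator {0..x} t *\<^sub>R (y powr \<alpha> - t powr \<alpha>)) \<le> y powr \<alpha> + x powr \<alpha>"
        by (cases "t \<in> {0..x}") (auto simp: abs_le_iff intro: add_increasing order_trans[OF _ powr_ge_zero])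
    qed
  qed measurable
  show ?thesis
    unfolding subgradient_pair_def
  proof (intro conjI allI impI)
    have "williamson \<alpha> F 0 = measure ?\<mu> {0..0}"
      unfolding williamson_def set_lebesgue_integral_def by simp
    then show "williamson \<alpha> F 0 = F 0" by (simp only: mass[OF order_refl])
  next
    fix x y :: real assume xy: "0 \<le> x" "0 \<le> y"
    have "F x * (y powr \<alpha> - x powr \<alpha>) = (LINT t:{0..x}|?\<mu>. y powr \<alpha> - x powr \<alpha>)"
      unfolding set_lebesgue_integral_def using mass[OF xy(1)] by simp
    moreover have "(LINT t:{0..x}|?\<mu>. x powr \<alpha> - t powr \<alpha>) + (LINT t:{0..x}|?\<mu>. y powr \<alpha> - x powr \<alpha>)
        = (LINT t:{0..x}|?\<mu>. (x powr \<alpha> - t powr \<alpha>) + (y powr \<alpha> - x powr \<alpha>))"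
      by (intro set_integral_add(2)[symmetric] int)
         (simp add: set_integrable_def less_top[symmetric])
    ultimately have "x powr \<alpha> * williamson \<alpha> F x + F x * (y powr \<alpha> - x powr \<alpha>)
        = (LINT t:{0..x}|?\<mu>. y powr \<alpha> - t powr \<alpha>)"
      by (simp add: scaled_williamson[OF \<open>\<alpha> > 0\<close> xy(1)])
    also have "\<dots> \<le> (LINT t:{0..y}|?\<mu>. y powr \<alpha> - t powr \<alpha>)"
      unfolding set_lebesgue_integral_def
    proof (rule integral_mono)
      fix t :: real
      have "t powr \<alpha> \<le> y powr \<alpha>" if "0 \<le> t" "t \<le> y"
        using that \<open>\<alpha> > 0\<close> by (intro powr_mono2) auto
      moreover have "y powr \<alpha> \<le> t powr \<alpha>" if "y < t"
        using that \<open>\<alpha> > 0\<close> xy by (intro powr_mono2) auto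
      ultimately show "indicator {0..x} t *\<^sub>R (y powr \<alpha> - t powr \<alpha>)
          \<le> indicator {0..y} t *\<^sub>R (y powr \<alpha> - t powr \<alpha>)"
        by (auto simp: indicator_def not_le)
    qed (use int in \<open>auto simp: set_integrable_def\<close>)
    also have "\<dots> = y powr \<alpha> * williamson \<alpha> F y"
      by (rule scaled_williamson[OF \<open>\<alpha> > 0\<close> xy(2), symmetric])
    finally show "x powr \<alpha> * williamson \<alpha> F x + F x * (y powr \<alpha> - x powr \<alpha>)
        \<le> y powr \<alpha> * williamson \<alpha> F y" .
  qed
qed

text \<open>
  Both functions \<open>u * G\<close> and \<open>u * H\<close> have increments over \<open>[u, v]\<close> between
  \<open>K u * (v - u)\<close> and \<open>K v * (v - u)\<close>, so the increments of their difference are bounded as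
  \<open>const_if_increment_le_mesh\<close> requires.
\<close>

lemma subgradient_pair_transform_unique:
  assumes "\<alpha> > 0" and G: "subgradient_pair \<alpha> F G" and H: "subgradient_pair \<alpha> F H" and "0 \<le> x"
  shows "G x = H x"
proof -
  define D where "D u = u * G (u powr (1/\<alpha>)) - u * H (u powr (1/\<alpha>))" for u
  define K where "K u = F (u powr (1/\<alpha>))" for u
  have inv: "(u powr (1/\<alpha>)) powr \<alpha> = u" if "0 \<le> u" for u
    using that \<open>\<alpha> > 0\<close> by (simp add: powr_powr)
  have "D (x powr \<alpha>) = D 0"
  proof (rule const_if_increment_le_mesh[where K=K])
    fix u v :: real assume uv: "0 \<le> u" "u \<le> v"
    have sub: "u * G (u powr (1/\<alpha>)) + K u * (v - u) \<le> v * G (v powr (1/\<alpha>))"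
      "u * H (u powr (1/\<alpha>)) + K u * (v - u) \<le> v * H (v powr (1/\<alpha>))"
      "v * G (v powr (1/\<alpha>)) + K v * (u - v) \<le> u * G (u powr (1/\<alpha>))"
      "v * H (v powr (1/\<alpha>)) + K v * (u - v) \<le> u * H (u powr (1/\<alpha>))"
      using subgradient_pairD[OF G, of "u powr (1/\<alpha>)" "v powr (1/\<alpha>)"]
        subgradient_pairD[OF H, of "u powr (1/\<alpha>)" "v powr (1/\<alpha>)"]
        subgradient_pairD[OF G, of "v powr (1/\<alpha>)" "u powr (1/\<alpha>)"]
        subgradient_pairD[OF H, of "v powr (1/\<alpha>)" "u powr (1/\<alpha>)"] uv
      by (simp_all add: inv K_def)
    then show "\<bar>D v - D u\<bar> \<le> (v - u) * (K v - K u)"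
      unfolding D_def abs_le_iff by (simp add: algebra_simps)
  qed simp
  then have "x powr \<alpha> * G x = x powr \<alpha> * H x"
    using \<open>0 \<le> x\<close> \<open>\<alpha> > 0\<close> by (simp add: D_def powr_powr)
  moreover have "G 0 = H 0" using G H by (simp add: subgradient_pair_def)
  ultimately show ?thesis using \<open>0 \<le> x\<close> by (cases "x = 0") auto
qed

text \<open>
  Equal transforms have equal difference quotients over \<open>[x, y]\<close>, which are at least \<open>F x\<close> and
  at most \<open>K y\<close>. Letting \<open>y\<close> decrease to \<open>x\<close> recovers a distribution function from its
  transform in the next lemma.
\<close>

lemma subgradient_pair_le_of_less:
  assumes "\<alpha> > 0" and F: "subgradient_pair \<alpha> F G" and K: "subgradient_pair \<alpha> K H"
    and eq: "\<And>x. x > 0 \<Longrightarrow> G x = H x" and "0 \<le> x" "x < y"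
  shows "F x \<le> K y"
proof -
  have pos: "0 < y powr \<alpha> - x powr \<alpha>"
    using assms by (simp add: powr_less_mono2)
  have "x powr \<alpha> * G x = x powr \<alpha> * H x" "y powr \<alpha> * G y = y powr \<alpha> * H y"
    using eq assms by (cases "x = 0"; simp)+
  moreover have "x powr \<alpha> * G x + F x * (y powr \<alpha> - x powr \<alpha>) \<le> y powr \<alpha> * G y"
    "y powr \<alpha> * H y + K y * (x powr \<alpha> - y powr \<alpha>) \<le> x powr \<alpha> * H x"
    using subgradient_pairD[OF F, of x y] subgradient_pairD[OF K, of y x] assms by simp_all
  ultimately have "F x * (y powr \<alpha> - x powr \<alpha>) \<le> - (K y * (x powr \<alpha> - y powr \<alpha>))"
    by linarith
  then have "F x * (y powr \<alpha> - x powr \<alpha>) \<le> K y * (y powr \<alpha> - x powr \<alpha>)"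
    by (simp add: right_diff_distrib)
  then show ?thesis using pos by simp
qed

lemma dist_fun_eqI_williamson:
  assumes "\<alpha> > 0" and F: "dist_fun_nonneg F" and K: "dist_fun_nonneg K"
    and eq: "\<And>x. x > 0 \<Longrightarrow> williamson \<alpha> F x = williamson \<alpha> K x"
  shows "F = K"
proof -
  have le: "P x \<le> Q x"
    if P: "dist_fun_nonneg P" and Q: "dist_fun_nonneg Q"
      and PQ: "\<And>x. x > 0 \<Longrightarrow> williamson \<alpha> P x = williamson \<alpha> Q x" for P Q x
  proof (cases "x < 0")
    case True
    then show ?thesis using P Q by (simp add: dist_fun_nonneg_def)
  next
    case False
    have "(Q \<longlongrightarrow> Q x) (at_right x)"
      using Q by (simp add: dist_fun_nonneg_def continuous_within)
    moreover have "eventually (\<lambda>y. P x \<le> Q y) (at_right x)"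
      using subgradient_pair_le_of_less[OF \<open>\<alpha> > 0\<close> subgradient_pair_williamson[OF \<open>\<alpha> > 0\<close> P]
          subgradient_pair_williamson[OF \<open>\<alpha> > 0\<close> Q] PQ] False
      by (auto simp: eventually_at_filter)
    ultimately show ?thesis
      by (rule tendsto_lowerbound) simp
  qed
  show ?thesis
    using le[OF F K eq] le[OF K F eq[symmetric]] by (intro ext antisym)
qed

text \<open>
  All three facts are instances of the subgradient inequality: \<open>G x \<le> F x\<close> is the case
  \<open>y = 0\<close>, nonnegativity the case of base point 0, and monotonicity follows after replacing
  \<open>F x\<close> by the smaller \<open>G x\<close>.
\<close>

lemma subgradient_pair_bounds:
  assumes "\<alpha> > 0" and P: "subgradient_pair \<alpha> F G" and "0 \<le> F 0" and "0 \<le> x"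
  shows subgradient_pair_le: "G x \<le> F x"
    and subgradient_pair_nonneg: "0 \<le> G x"
    and subgradient_pair_mono: "x \<le> y \<Longrightarrow> G x \<le> G y"
proof -
  have G0: "G 0 = F 0" using P by (simp add: subgradient_pair_def)
  have le: "G u \<le> F u" if "0 \<le> u" for u
    using subgradient_pairD[OF P that order_refl] G0 that
    by (cases "u = 0") (auto simp: algebra_simps)
  show "G x \<le> F x" using le[OF \<open>0 \<le> x\<close>] .
  have "F 0 * x powr \<alpha> \<le> x powr \<alpha> * G x"
    using subgradient_pairD[OF P order_refl \<open>0 \<le> x\<close>] by simp
  then show "0 \<le> G x"
    using G0 assms by (cases "x = 0") (auto simp: mult.commute intro: order_trans)
  assume "x \<le> y"
  then have "x powr \<alpha> \<le> y powr \<alpha>" using assms by (intro powr_mono2) auto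
  then have "G x * (y powr \<alpha> - x powr \<alpha>) \<le> F x * (y powr \<alpha> - x powr \<alpha>)"
    using le[OF \<open>0 \<le> x\<close>] by (intro mult_right_mono) auto
  then have "G x * y powr \<alpha> \<le> G y * y powr \<alpha>"
    using subgradient_pairD[OF P \<open>0 \<le> x\<close>, of y] \<open>0 \<le> x\<close> \<open>x \<le> y\<close> by (simp add: algebra_simps)
  then show "G x \<le> G y"
    using \<open>0 \<le> x\<close> \<open>x \<le> y\<close> by (cases "y = 0") auto
qed

text \<open>
  This is the product rule. With \<open>u = x powr \<alpha>\<close>, \<open>v = y powr \<alpha>\<close> and the two affine minorants
  \<open>l1\<close>, \<open>l2\<close> of \<open>v * G1\<close>, \<open>v * G2\<close> at \<open>x\<close>, the claimed affine minorant \<open>T\<close> of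
  \<open>v * G1 * G2\<close> satisfies \<open>v * T = l1 * l2 - (v - u)^2 * (F1 - G1) * (F2 - G2)\<close>, where the last
  product is nonnegative. If \<open>l1\<close> and \<open>l2\<close> are nonnegative, multiplying the two subgradient
  inequalities is legitimate and gives the claim. If one of them is negative, then \<open>y < x\<close> and already
  \<open>T \<le> 0\<close>.
\<close>

lemma subgradient_pair_mult:
  assumes "\<alpha> > 0" and P1: "subgradient_pair \<alpha> F1 G1" and P2: "subgradient_pair \<alpha> F2 G2"
    and "0 \<le> F1 0" "0 \<le> F2 0"
  shows "subgradient_pair \<alpha> (\<lambda>x. F1 x * G2 x + F2 x * G1 x - G1 x * G2 x) (\<lambda>x. G1 x * G2 x)"
  unfolding subgradient_pair_def
proof (intro conjI allI impI)
  show "G1 0 * G2 0 = F1 0 * G2 0 + F2 0 * G1 0 - G1 0 * G2 0"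
    using P1 P2 by (simp add: subgradient_pair_def)
next
  fix x y :: real assume xy: "0 \<le> x" "0 \<le> y"
  note b1 = subgradient_pair_le[OF \<open>\<alpha> > 0\<close> P1 \<open>0 \<le> F1 0\<close>] subgradient_pair_nonneg[OF \<open>\<alpha> > 0\<close> P1 \<open>0 \<le> F1 0\<close>]
  note b2 = subgradient_pair_le[OF \<open>\<alpha> > 0\<close> P2 \<open>0 \<le> F2 0\<close>] subgradient_pair_nonneg[OF \<open>\<alpha> > 0\<close> P2 \<open>0 \<le> F2 0\<close>]
  define u v where "u = x powr \<alpha>" and "v = y powr \<alpha>"
  define p q a b where "p = F1 x" and "q = F2 x" and "a = G1 x" and "b = G2 x"
  have uv: "0 \<le> u" "0 \<le> v" by (simp_all add: u_def v_def)
  have ab: "0 \<le> a" "0 \<le> b" "a \<le> p" "b \<le> q"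
    using b1[OF xy(1)] b2[OF xy(1)] by (simp_all add: a_def b_def p_def q_def)
  define l1 l2 where "l1 = u * a + p * (v - u)" and "l2 = u * b + q * (v - u)"
  have l: "l1 \<le> v * G1 y" "l2 \<le> v * G2 y"
    using subgradient_pairD[OF P1 xy] subgradient_pairD[OF P2 xy]
    by (simp_all add: l1_def l2_def u_def v_def a_def b_def p_def q_def)
  have W: "0 \<le> v * G1 y" "0 \<le> v * G2 y" using b1(2)[OF xy(2)] b2(2)[OF xy(2)] uv by simp_all
  define T where "T = u * (a * b) + (p * b + q * a - a * b) * (v - u)"
  have id1: "v * T = l1 * l2 - (v - u)^2 * ((p - a) * (q - b))"
    by (simp add: T_def l1_def l2_def power2_eq_square algebra_simps)
  have id2: "T = b * l1 + a * (q - b) * (v - u)" and id3: "T = a * l2 + b * (p - a) * (v - u)"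
    by (simp_all add: T_def l1_def l2_def algebra_simps)
  have "T \<le> v * (G1 y * G2 y)"
  proof (cases "0 \<le> l1 \<and> 0 \<le> l2")
    case True
    have "v * T \<le> l1 * l2" unfolding id1 using ab by simp
    also have "\<dots> \<le> (v * G1 y) * (v * G2 y)" using True l by (intro mult_mono) auto
    finally have "v * T \<le> v * (v * (G1 y * G2 y))" by (simp add: algebra_simps)
    moreover have "T = 0" if "v = 0"
    proof -
      have "l1 = 0 \<or> l1 \<le> 0" "l2 \<le> 0" using l that by auto
      then have z: "l1 = 0" "l2 = 0" using True by auto
      have "u * (a - p) = 0" "u * (b - q) = 0"
        using z that by (simp_all add: l1_def l2_def algebra_simps)
      then show ?thesis using that by (auto simp: T_def)
    qed
    ultimately show ?thesis using uv by (cases "v = 0") auto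
  next
    case False
    have "v - u \<le> 0"
    proof (rule ccontr)
      assume "\<not> v - u \<le> 0"
      then have "0 \<le> l1" "0 \<le> l2" using uv ab by (auto simp: l1_def l2_def)
      then show False using False by simp
    qed
    then have *: "a * (q - b) * (v - u) \<le> 0" "b * (p - a) * (v - u) \<le> 0"
      using ab by (auto intro!: mult_nonneg_nonpos)
    from False have "T \<le> 0"
    proof (cases "l1 < 0")
      case True
      then show ?thesis using * id2 ab mult_nonneg_nonpos[of b l1] by linarith
    next
      case 2: False
      then show ?thesis using False * id3 ab mult_nonneg_nonpos[of a l2] by linarith
    qed
    also have "0 \<le> v * (G1 y * G2 y)" using b1(2)[OF xy(2)] b2(2)[OF xy(2)] uv by simp
    finally show ?thesis .
  qed
  then show "x powr \<alpha> * (G1 x * G2 x) + (F1 x * G2 x + F2 x * G1 x - G1 x * G2 x) * (y powr \<alpha> - x powr \<alpha>)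
     \<le> y powr \<alpha> * (G1 y * G2 y)"
    by (simp add: T_def u_def v_def a_def b_def p_def q_def)
qed

lemma dist_fun_nonneg_range:
  assumes "dist_fun_nonneg F" shows "0 \<le> F x" "F x \<le> 1"
proof -
  interpret real_distribution "interval_measure F"
    using dist_fun_nonneg_real_distribution[OF assms] by simp
  show "0 \<le> F x" "F x \<le> 1"
    using cdf_nonneg[of x] cdf_bounded_prob[of x] dist_fun_nonneg_real_distribution(2)[OF assms] by simp_all
qed

lemma williamson_bounds:
  assumes "\<alpha> > 0" "dist_fun_nonneg F" "0 \<le> x"
  shows williamson_le: "williamson \<alpha> F x \<le> F x"
    and williamson_nonneg: "0 \<le> williamson \<alpha> F x"
    and williamson_mono: "x \<le> y \<Longrightarrow> williamson \<alpha> F x \<le> williamson \<alpha> F y"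
  using subgradient_pair_bounds[OF assms(1) subgradient_pair_williamson[OF assms(1,2)]
      dist_fun_nonneg_range(1)[OF assms(2)] assms(3)] by blast+

text \<open>
  At \<open>x > 0\<close> the subgradient inequality based at \<open>y\<close>, with \<open>F y \<le> 1\<close>, bounds the
  increment of \<open>y powr \<alpha> * G y\<close> by that of \<open>y powr \<alpha>\<close>. At 0 this bound gives nothing,
  but there \<open>G\<close> is squeezed between \<open>F 0\<close> and the right continuous \<open>F\<close>.
\<close>

lemma williamson_right_continuous:
  assumes "\<alpha> > 0" and F: "dist_fun_nonneg F" and "0 \<le> x"
  shows "(williamson \<alpha> F \<longlongrightarrow> williamson \<alpha> F x) (at_right x)"
proof -
  note P = subgradient_pair_williamson[OF \<open>\<alpha> > 0\<close> F]
  note le = williamson_le[OF \<open>\<alpha> > 0\<close> F] and mon = williamson_mono[OF \<open>\<alpha> > 0\<close> F]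
  show ?thesis
  proof (cases "x = 0")
    case True
    have "williamson \<alpha> F 0 = F 0" using P by (simp add: subgradient_pair_def)
    moreover have "(F \<longlongrightarrow> F 0) (at_right 0)"
      using F by (simp add: dist_fun_nonneg_def continuous_within)
    ultimately have lim: "(F \<longlongrightarrow> williamson \<alpha> F 0) (at_right 0)" by simp
    show ?thesis unfolding True
    proof (rule tendsto_sandwich[OF _ _ tendsto_const lim])
      show "\<forall>\<^sub>F y in at_right 0. williamson \<alpha> F 0 \<le> williamson \<alpha> F y"
        using mon[OF order_refl] by (auto simp: eventually_at_filter)
      show "\<forall>\<^sub>F y in at_right 0. williamson \<alpha> F y \<le> F y"
        using le by (auto simp: eventually_at_filter)
    qed
  next
    case False
    then have "x > 0" using \<open>0 \<le> x\<close> by simp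
    let ?G = "williamson \<alpha> F"
    have upper: "?G y \<le> (x powr \<alpha> * ?G x + (y powr \<alpha> - x powr \<alpha>)) / y powr \<alpha>" if "x < y" for y
    proof -
      have "x powr \<alpha> \<le> y powr \<alpha>" using that \<open>\<alpha> > 0\<close> \<open>x > 0\<close> by (intro powr_mono2) auto
      then have "F y * (y powr \<alpha> - x powr \<alpha>) \<le> 1 * (y powr \<alpha> - x powr \<alpha>)"
        using dist_fun_nonneg_range(2)[OF F] by (intro mult_right_mono) auto
      then have "y powr \<alpha> * ?G y \<le> x powr \<alpha> * ?G x + (y powr \<alpha> - x powr \<alpha>)"
        using subgradient_pairD[OF P, of y x] that \<open>x > 0\<close> by (simp add: algebra_simps)
      then show ?thesis using that \<open>x > 0\<close> by (simp add: field_simps)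
    qed
    have "((\<lambda>y. (x powr \<alpha> * ?G x + (y powr \<alpha> - x powr \<alpha>)) / y powr \<alpha>)
        \<longlongrightarrow> (x powr \<alpha> * ?G x + (x powr \<alpha> - x powr \<alpha>)) / x powr \<alpha>) (at_right x)"
      using \<open>x > 0\<close> by (intro tendsto_intros) auto
    then have lim: "((\<lambda>y. (x powr \<alpha> * ?G x + (y powr \<alpha> - x powr \<alpha>)) / y powr \<alpha>) \<longlongrightarrow> ?G x) (at_right x)"
      using \<open>x > 0\<close> by simp
    show ?thesis
    proof (rule tendsto_sandwich[OF _ _ tendsto_const lim])
      show "\<forall>\<^sub>F y in at_right x. ?G x \<le> ?G y"
        using mon[OF \<open>0 \<le> x\<close>] by (auto simp: eventually_at_filter)
      show "\<forall>\<^sub>F y in at_right x. ?G y \<le> (x powr \<alpha> * ?G x + (y powr \<alpha> - x powr \<alpha>)) / y powr \<alpha>"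
        using upper by (auto simp: eventually_at_filter)
    qed
  qed
qed

text \<open>
  For a fixed base point \<open>x\<close> the subgradient inequality makes every limit point of \<open>G\<close> at
  infinity at least \<open>F x\<close>, and \<open>F x\<close> can be chosen close to 1.
\<close>

lemma williamson_tendsto_1:
  assumes "\<alpha> > 0" and F: "dist_fun_nonneg F"
  shows "(williamson \<alpha> F \<longlongrightarrow> 1) at_top"
proof (rule order_tendstoI)
  fix a :: real assume "1 < a"
  show "\<forall>\<^sub>F x in at_top. williamson \<alpha> F x < a"
    using eventually_ge_at_top[of 0]
  proof eventually_elim
    case (elim x)
    then show ?case
      using williamson_le[OF assms elim] dist_fun_nonneg_range(2)[OF F, of x] \<open>1 < a\<close> by linarith
  qed
next
  fix a :: real assume "a < 1"
  have "\<forall>\<^sub>F x in at_top. a < F x"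
    using F \<open>a < 1\<close> unfolding dist_fun_nonneg_def by (auto dest: order_tendstoD(1))
  then have "\<forall>\<^sub>F x in at_top. a < F x \<and> 0 \<le> x"
    using eventually_ge_at_top[of 0] by eventually_elim simp
  then obtain x where x: "a < F x" "0 \<le> x"
    by (auto simp: eventually_at_top_linorder)
  have "((\<lambda>y. 1 - x powr \<alpha> * y powr (-\<alpha>)) \<longlongrightarrow> 1 - x powr \<alpha> * 0) at_top"
    using \<open>\<alpha> > 0\<close> by (intro tendsto_intros tendsto_neg_powr filterlim_ident) auto
  then have "((\<lambda>y. F x * (1 - x powr \<alpha> * y powr (-\<alpha>))) \<longlongrightarrow> F x * 1) at_top"
    by (intro tendsto_mult tendsto_const) simp
  then have "\<forall>\<^sub>F y in at_top. a < F x * (1 - x powr \<alpha> * y powr (-\<alpha>))"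
    using x by (auto dest: order_tendstoD(1))
  then show "\<forall>\<^sub>F y in at_top. a < williamson \<alpha> F y"
    using eventually_gt_at_top[of 0]
  proof eventually_elim
    case (elim y)
    have "F x * (y powr \<alpha> - x powr \<alpha>) \<le> y powr \<alpha> * williamson \<alpha> F y"
      using subgradient_pairD[OF subgradient_pair_williamson[OF assms] x(2), of y] elim
        mult_nonneg_nonneg[OF powr_ge_zero[of x \<alpha>] williamson_nonneg[OF assms x(2)]] by linarith
    then have "F x * (1 - x powr \<alpha> * y powr (-\<alpha>)) \<le> williamson \<alpha> F y"
      using elim by (simp add: powr_minus field_simps)
    then show ?case using elim by linarith
  qed
qed

section \<open>Kendall convolution, powers and renewal function in closed form\<close>

text \<open>
  By \<open>subgradient_pair_mult\<close> the function \<open>H = F1 * G2 + F2 * G1 - G1 * G2\<close> forms a subgradient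
  pair with \<open>G1 * G2\<close>, so once \<open>H\<close> is known to be a distribution function its transform must be
  \<open>G1 * G2\<close>, and injectivity of the transform makes \<open>H\<close> the convolution.
\<close>

lemma
  assumes "\<alpha> > 0" and F1: "dist_fun_nonneg F1" and F2: "dist_fun_nonneg F2"
  shows dist_fun_nonneg_kendall_conv: "dist_fun_nonneg (kendall_conv \<alpha> F1 F2)"
    and williamson_kendall_conv:
      "\<And>x. 0 \<le> x \<Longrightarrow> williamson \<alpha> (kendall_conv \<alpha> F1 F2) x = williamson \<alpha> F1 x * williamson \<alpha> F2 x"
    and kendall_conv_eq:
      "\<And>x. kendall_conv \<alpha> F1 F2 x = F1 x * williamson \<alpha> F2 x + F2 x * williamson \<alpha> F1 x
         - williamson \<alpha> F1 x * williamson \<alpha> F2 x"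
proof -
  define G1 G2 where "G1 = williamson \<alpha> F1" and "G2 = williamson \<alpha> F2"
  define H where "H x = F1 x * G2 x + F2 x * G1 x - G1 x * G2 x" for x
  have neg: "F1 x = 0" "F2 x = 0" "G1 x = 0" "G2 x = 0" if "x < 0" for x
    using that F1 F2 by (simp_all add: dist_fun_nonneg_def G1_def G2_def williamson_def
        set_lebesgue_integral_def)
  note g1 = williamson_bounds[OF \<open>\<alpha> > 0\<close> F1, folded G1_def]
    and g2 = williamson_bounds[OF \<open>\<alpha> > 0\<close> F2, folded G2_def]
  have H: "dist_fun_nonneg H"
    unfolding dist_fun_nonneg_def
  proof (intro conjI allI impI)
    have mono0: "H x \<le> H y" if xy: "0 \<le> x" "x \<le> y" for x y
    proof -
      have F: "F1 x \<le> F1 y" "F2 x \<le> F2 y"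
        using F1 F2 xy by (simp_all add: dist_fun_nonneg_def mono_def)
      have G: "G1 x \<le> G1 y" "G2 x \<le> G2 y" using g1(3) g2(3) xy by auto
      \<comment> \<open>Raising \<open>F1\<close>, \<open>F2\<close>, \<open>G1\<close>, \<open>G2\<close> from \<open>x\<close> to \<open>y\<close> one after the other, in this
        order, never lowers \<open>H\<close>, since \<open>G\<close> stays below \<open>F\<close>.\<close>
      have "H y - H x = G2 x * (F1 y - F1 x) + G1 x * (F2 y - F2 x)
          + (G1 y - G1 x) * (F2 y - G2 x) + (G2 y - G2 x) * (F1 y - G1 y)"
        by (simp add: H_def algebra_simps)
      moreover have "G2 x \<le> F2 y" "G1 y \<le> F1 y"
        using G g2(1)[of y] g1(1)[of y] xy by auto
      ultimately have "0 \<le> H y - H x"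
        using F G g1(2)[OF xy(1)] g2(2)[OF xy(1)] by simp
      then show ?thesis by simp
    qed
    have H0: "H x = 0" if "x < 0" for x using neg[OF that] by (simp add: H_def)
    have Hnn: "0 \<le> H x" if "0 \<le> x" for x
    proof -
      have "H x = F1 x * G2 x + (F2 x - G2 x) * G1 x" by (simp add: H_def algebra_simps)
      then show ?thesis
        using g1(1,2)[OF that] g2(1,2)[OF that] dist_fun_nonneg_range(1)[OF F1] by simp
    qed
    show "mono H"
    proof (rule monoI)
      fix x y :: real assume "x \<le> y"
      then show "H x \<le> H y"
        using mono0[of x y] H0[of x] H0[of y] Hnn[of y]
        by (cases "x < 0"; cases "y < 0") auto
    qed
    show "H x = 0" if "x < 0" for x by (rule H0[OF that])
    show "continuous (at_right x) H" for x
    proof (cases "x < 0")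
      case True
      have "\<forall>\<^sub>F y in at_right x. H y = 0"
        using eventually_at_right_less[of x] order_tendstoD(2)[OF tendsto_ident_at True]
        by eventually_elim (simp add: H0)
      then show ?thesis using True
        by (simp add: continuous_within H0 tendsto_eventually)
    next
      case False
      have "(F1 \<longlongrightarrow> F1 x) (at_right x)" "(F2 \<longlongrightarrow> F2 x) (at_right x)"
        using F1 F2 by (simp_all add: dist_fun_nonneg_def continuous_within)
      moreover have "(G1 \<longlongrightarrow> G1 x) (at_right x)" "(G2 \<longlongrightarrow> G2 x) (at_right x)"
        using williamson_right_continuous[OF \<open>\<alpha> > 0\<close>] F1 F2 False by (simp_all add: G1_def G2_def)
      ultimately show ?thesis
        unfolding continuous_within H_def by (intro tendsto_intros)
    qed
    have "((\<lambda>x. F1 x * G2 x + F2 x * G1 x - G1 x * G2 x) \<longlongrightarrow> 1 * 1 + 1 * 1 - 1 * 1) at_top"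
      using F1 F2 williamson_tendsto_1[OF \<open>\<alpha> > 0\<close>]
      by (intro tendsto_intros) (simp_all add: G1_def G2_def dist_fun_nonneg_def)
    then show "(H \<longlongrightarrow> 1) at_top" by (simp add: H_def[abs_def])
  qed
  have pair: "subgradient_pair \<alpha> H (\<lambda>x. G1 x * G2 x)"
    unfolding H_def[abs_def] G1_def G2_def
    by (intro subgradient_pair_mult subgradient_pair_williamson dist_fun_nonneg_range assms)
  have wH: "williamson \<alpha> H x = G1 x * G2 x" if "0 \<le> x" for x
    using subgradient_pair_transform_unique[OF \<open>\<alpha> > 0\<close> subgradient_pair_williamson[OF \<open>\<alpha> > 0\<close> H] pair that] .
  have conv: "kendall_conv \<alpha> F1 F2 = H"
    unfolding kendall_conv_def
  proof (rule the_equality)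
    show "dist_fun_nonneg H \<and> (\<forall>x>0. williamson \<alpha> H x = williamson \<alpha> F1 x * williamson \<alpha> F2 x)"
      using H wH by (simp add: G1_def G2_def)
  next
    fix K assume "dist_fun_nonneg K \<and> (\<forall>x>0. williamson \<alpha> K x = williamson \<alpha> F1 x * williamson \<alpha> F2 x)"
    then show "K = H"
      using dist_fun_eqI_williamson[OF \<open>\<alpha> > 0\<close> _ H, of K] wH by (simp add: G1_def G2_def)
  qed
  show "dist_fun_nonneg (kendall_conv \<alpha> F1 F2)"
    and "\<And>x. 0 \<le> x \<Longrightarrow> williamson \<alpha> (kendall_conv \<alpha> F1 F2) x = williamson \<alpha> F1 x * williamson \<alpha> F2 x"
    and "\<And>x. kendall_conv \<alpha> F1 F2 x = F1 x * williamson \<alpha> F2 x + F2 x * williamson \<alpha> F1 x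
         - williamson \<alpha> F1 x * williamson \<alpha> F2 x"
    unfolding conv using H wH by (simp_all add: H_def G1_def G2_def)
qed

lemma dist_fun_nonneg_cdf:
  assumes "real_distribution M" and neg: "\<And>x. x < 0 \<Longrightarrow> cdf M x = 0"
  shows "dist_fun_nonneg (cdf M)"
proof -
  interpret real_distribution M by fact
  show ?thesis
    using neg by (auto simp: dist_fun_nonneg_def mono_def cdf_nondecreasing cdf_is_right_cont cdf_lim_at_top_prob)
qed

lemma interval_measure_cdf:
  assumes "real_distribution M" and neg: "\<And>x. x < 0 \<Longrightarrow> cdf M x = 0"
  shows "interval_measure (cdf M) = M"
  using dist_fun_nonneg_real_distribution[OF dist_fun_nonneg_cdf[OF assms]] assms(1)
  by (intro cdf_unique) auto

text \<open>
  The correction \<open>F - G\<close> is \<open>u * dG / du\<close> in the variable \<open>u = x powr \<alpha>\<close>, so the formula is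
  the derivative of \<open>u * G ^ n\<close>. For \<open>n = 0\<close> the second summand vanishes through its factor
  \<open>n\<close>, and the truncated exponent \<open>n - 1\<close> does no harm.
\<close>

lemma kendall_power_closed_form:
  assumes "\<alpha> > 0" and F: "dist_fun_nonneg F"
  defines "G \<equiv> williamson \<alpha> F"
  shows "dist_fun_nonneg (kendall_power \<alpha> F n)
    \<and> (\<forall>x\<ge>0. williamson \<alpha> (kendall_power \<alpha> F n) x = G x ^ n)
    \<and> (\<forall>x\<ge>0. kendall_power \<alpha> F n x = G x ^ n + real n * G x ^ (n - 1) * (F x - G x))"
proof (induction n)
  case 0
  let ?\<delta> = "return borel (0::real)"
  have \<delta>: "real_distribution ?\<delta>"
    by (simp add: real_distribution_def real_distribution_axioms_def prob_space_return)
  have cdf\<delta>: "cdf ?\<delta> = indicator {0..}"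
    by (simp add: fun_eq_iff cdf_def measure_return indicator_def)
  have neg: "cdf ?\<delta> x = 0" if "x < 0" for x using that by (simp add: cdf\<delta>)
  have "interval_measure (cdf ?\<delta>) = ?\<delta>"
    using \<delta> neg by (rule interval_measure_cdf)
  note measure_cdf = this
  have "williamson \<alpha> (cdf ?\<delta>) x = 1" if "0 \<le> x" for x
    unfolding williamson_def set_lebesgue_integral_def measure_cdf
    using that by (subst integral_return) auto
  then show ?case
    using dist_fun_nonneg_cdf[OF \<delta> neg] by (auto simp: cdf\<delta>)
next
  case (Suc n)
  define P where "P = kendall_power \<alpha> F n"
  have P: "dist_fun_nonneg P" "\<And>x. x \<ge> 0 \<Longrightarrow> williamson \<alpha> P x = G x ^ n"
    "\<And>x. x \<ge> 0 \<Longrightarrow> P x = G x ^ n + real n * G x ^ (n - 1) * (F x - G x)"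
    using Suc by (simp_all add: P_def)
  have "kendall_conv \<alpha> P F x = G x ^ Suc n + real (Suc n) * G x ^ n * (F x - G x)" if "0 \<le> x" for x
  proof -
    have "kendall_conv \<alpha> P F x = P x * G x + F x * G x ^ n - G x ^ n * G x"
      using kendall_conv_eq[OF \<open>\<alpha> > 0\<close> P(1) F] P(2)[OF that] by (simp add: G_def)
    also have "\<dots> = G x ^ Suc n + real (Suc n) * G x ^ n * (F x - G x)"
      unfolding P(3)[OF that] by (cases n) (simp_all add: algebra_simps)
    finally show ?thesis .
  qed
  then show ?case
    using dist_fun_nonneg_kendall_conv[OF \<open>\<alpha> > 0\<close> P(1) F] williamson_kendall_conv[OF \<open>\<alpha> > 0\<close> P(1) F] P(2)
    by (simp add: P_def[symmetric] G_def)
qed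

text \<open>
  Summing the closed form gives the geometric series and its derivative. The assumption \<open>F x < 1\<close>
  guarantees \<open>G x < 1\<close>.
\<close>

lemma kendall_renewal_eq:
  assumes "\<alpha> > 0" and F: "dist_fun_nonneg F" and "0 \<le> x" and "F x < 1"
  shows "kendall_renewal \<alpha> F x
    = 2 / (1 - williamson \<alpha> F x) - (1 - F x) / (1 - williamson \<alpha> F x)^2"
proof -
  define z where "z = williamson \<alpha> F x"
  have z: "0 \<le> z" "z < 1"
    using williamson_bounds[OF assms(1-3)] \<open>F x < 1\<close> by (auto simp: z_def)
  have geo: "(\<lambda>n. z ^ n) sums (1 / (1 - z))"
    using z by (intro geometric_sums) auto
  have "(\<lambda>n. of_nat (Suc n) * z ^ n) sums (1 / (1 - z)^2)"
    using z by (intro geometric_deriv_sums) auto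
  then have "(\<lambda>n. real n * z ^ (n - 1)) sums (1 / (1 - z)^2)"
    using sums_Suc_iff[of "\<lambda>n. real n * z ^ (n - 1)"] by simp
  from sums_add[OF geo sums_mult2[OF this, of "F x - z"]]
  have "(\<lambda>n. kendall_power \<alpha> F n x) sums (1 / (1 - z) + 1 / (1 - z)^2 * (F x - z))"
    using kendall_power_closed_form[OF \<open>\<alpha> > 0\<close> F] \<open>0 \<le> x\<close> by (simp add: z_def mult.assoc)
  then have "kendall_renewal \<alpha> F x = 1 / (1 - z) + 1 / (1 - z)^2 * (F x - z)"
    unfolding kendall_renewal_def by (rule sums_unique[symmetric])
  also have "\<dots> = 2 / (1 - z) - (1 - F x) / (1 - z)^2"
  proof -
    have "1 / (1 - z) = (1 - z) / (1 - z)^2" using z by (simp add: power2_eq_square)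
    then have "1 / (1 - z) + 1 / (1 - z)^2 * (F x - z) = (2 * (1 - z) - (1 - F x)) / (1 - z)^2"
      by (simp add: add_divide_distrib[symmetric])
    moreover have "2 * (1 - z) / (1 - z)^2 = 2 / (1 - z)"
      unfolding power2_eq_square using z by (intro nonzero_mult_divide_mult_cancel_right) simp
    ultimately show ?thesis by (simp only: diff_divide_distrib)
  qed
  finally show ?thesis by (simp add: z_def)
qed


section \<open>The excess of a positive random variable with finite moment\<close>

text \<open>
  The mean excess of \<open>X powr \<alpha>\<close> over \<open>x powr \<alpha>\<close>; it also equals the integral of
  \<open>\<alpha> * s powr (\<alpha> - 1) * P (X > s)\<close> over \<open>s > x\<close>. The expectation is easier to handle, since its
  increments can be bounded pointwise.
\<close>

definition tail_excess :: "real \<Rightarrow> 'a measure \<Rightarrow> ('a \<Rightarrow> real) \<Rightarrow> real \<Rightarrow> real" where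
  "tail_excess \<alpha> M X x = (LINT \<omega>|M. max 0 (X \<omega> powr \<alpha> - x powr \<alpha>))"

locale positive_moment_variable = prob_space M
  for M :: "'a measure" and X :: "'a \<Rightarrow> real" and \<alpha> :: real +
  assumes exponent_pos: "\<alpha> > 0"
    and measurable_X [measurable]: "X \<in> borel_measurable M"
    and X_pos: "AE \<omega> in M. X \<omega> > 0"
    and moment: "integrable M (\<lambda>\<omega>. X \<omega> powr \<alpha>)"
begin

abbreviation "F \<equiv> cdf (distr M borel X)"

abbreviation "m \<equiv> expectation (\<lambda>\<omega>. X \<omega> powr \<alpha>)"

abbreviation "\<delta> \<equiv> tail_excess \<alpha> M X"

lemma distribution_X: "real_distribution (distr M borel X)"
  by simp

lemma cdf_eq: "F x = prob {\<omega> \<in> space M. X \<omega> \<le> x}"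
  unfolding cdf_def by (subst measure_distr) (auto simp: vimage_def Int_def conj_commute)

lemma survival_eq: "1 - F x = expectation (indicator {\<omega> \<in> space M. x < X \<omega>})"
proof -
  have "1 - F x = prob (space M - {\<omega> \<in> space M. X \<omega> \<le> x})"
    unfolding cdf_eq by (subst prob_compl) auto
  also have "space M - {\<omega> \<in> space M. X \<omega> \<le> x} = {\<omega> \<in> space M. x < X \<omega>}" by auto
  finally show ?thesis by simp
qed

lemma cdf_neg: "x \<le> 0 \<Longrightarrow> F x = 0"
proof -
  assume "x \<le> 0"
  then have "AE \<omega> in M. \<not> X \<omega> \<le> x" using X_pos by (auto elim: eventually_mono)
  then show ?thesis unfolding cdf_eq by (subst prob_eq_0) auto
qed

lemma dist_fun_F: "dist_fun_nonneg F"
  by (rule dist_fun_nonneg_cdf[OF distribution_X cdf_neg]) simp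

lemma integrable_excess [simp]: "integrable M (\<lambda>\<omega>. max 0 (X \<omega> powr \<alpha> - x powr \<alpha>))"
  using moment by (intro integrable_max integrable_diff) auto

text \<open>
  Both sides are \<open>E (min X x) powr \<alpha>\<close>, because \<open>a - (a - b)\<^sup>+ = min a b\<close> in either order
  of the arguments.
\<close>

lemma scaled_williamson_defect:
  assumes "0 \<le> x"
  shows "x powr \<alpha> * (1 - williamson \<alpha> F x) = m - \<delta> x"
proof -
  have "interval_measure F = distr M borel X"
    by (rule interval_measure_cdf[OF distribution_X cdf_neg]) simp
  then have "x powr \<alpha> * williamson \<alpha> F x = (LINT t:{0..x}|distr M borel X. x powr \<alpha> - t powr \<alpha>)"
    using scaled_williamson[OF exponent_pos assms, of F] by (simp only:)
  also have "\<dots> = expectation (\<lambda>\<omega>. indicator {0..x} (X \<omega>) *\<^sub>R (x powr \<alpha> - X \<omega> powr \<alpha>))"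
    unfolding set_lebesgue_integral_def by (subst integral_distr) auto
  also have "\<dots> = expectation (\<lambda>\<omega>. x powr \<alpha> - X \<omega> powr \<alpha> + max 0 (X \<omega> powr \<alpha> - x powr \<alpha>))"
  proof (rule integral_cong_AE)
    show "AE \<omega> in M. indicator {0..x} (X \<omega>) *\<^sub>R (x powr \<alpha> - X \<omega> powr \<alpha>)
        = x powr \<alpha> - X \<omega> powr \<alpha> + max 0 (X \<omega> powr \<alpha> - x powr \<alpha>)"
      using X_pos
    proof eventually_elim
      case (elim \<omega>)
      have "X \<omega> \<le> x \<Longrightarrow> X \<omega> powr \<alpha> \<le> x powr \<alpha>" "x \<le> X \<omega> \<Longrightarrow> x powr \<alpha> \<le> X \<omega> powr \<alpha>"
        using elim assms exponent_pos by (auto intro: powr_mono2)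
      then show ?case using elim by (cases "X \<omega> \<le> x") auto
    qed
  qed measurable
  also have "\<dots> = x powr \<alpha> - m + \<delta> x"
    unfolding tail_excess_def using moment
    by (subst Bochner_Integration.integral_add) (auto simp: prob_space)
  finally show ?thesis by (simp add: algebra_simps)
qed

text \<open>
  The integrand of the difference is \<open>X powr \<alpha> - x powr \<alpha>\<close> cut off at 0 and at
  \<open>y powr \<alpha> - x powr \<alpha>\<close>: it attains its maximal value wherever \<open>X > y\<close> and vanishes
  unless \<open>X > x\<close>.
\<close>

lemma excess_increment:
  assumes "0 \<le> x" "x \<le> y"
  shows excess_increment_lower: "(1 - F y) * (y powr \<alpha> - x powr \<alpha>) \<le> \<delta> x - \<delta> y"
    and excess_increment_upper: "\<delta> x - \<delta> y \<le> (1 - F x) * (y powr \<alpha> - x powr \<alpha>)"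
proof -
  let ?I = "\<lambda>z \<omega>. indicator {\<omega> \<in> space M. z < X \<omega>} \<omega> * (y powr \<alpha> - x powr \<alpha>)"
  let ?d = "\<lambda>\<omega>. max 0 (X \<omega> powr \<alpha> - x powr \<alpha>) - max 0 (X \<omega> powr \<alpha> - y powr \<alpha>)"
  have diff: "\<delta> x - \<delta> y = expectation ?d"
    unfolding tail_excess_def by simp
  have surv: "(1 - F z) * (y powr \<alpha> - x powr \<alpha>) = expectation (?I z)" for z
    unfolding survival_eq by simp
  have int: "integrable M (?I z)" for z
    by (intro integrable_mult_left integrable_real_indicator) (auto simp: less_top[symmetric])
  have xy: "x powr \<alpha> \<le> y powr \<alpha>" using assms exponent_pos by (intro powr_mono2) auto
  have mono: "X \<omega> \<le> z \<Longrightarrow> X \<omega> powr \<alpha> \<le> z powr \<alpha>" "z \<le> X \<omega> \<Longrightarrow> z powr \<alpha> \<le> X \<omega> powr \<alpha>"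
    if "0 < X \<omega>" "0 \<le> z" for z \<omega>
    using that exponent_pos by (auto intro: powr_mono2)
  show "(1 - F y) * (y powr \<alpha> - x powr \<alpha>) \<le> \<delta> x - \<delta> y"
    unfolding diff surv
  proof (rule integral_mono_AE[OF int])
    show "AE \<omega> in M. ?I y \<omega> \<le> ?d \<omega>"
      using X_pos
    proof eventually_elim
      case (elim \<omega>)
      then show ?case using mono[OF elim, of y] xy assms by (auto simp: indicator_def max_def)
    qed
  qed simp
  show "\<delta> x - \<delta> y \<le> (1 - F x) * (y powr \<alpha> - x powr \<alpha>)"
    unfolding diff surv
  proof (rule integral_mono_AE[OF _ int])
    show "AE \<omega> in M. ?d \<omega> \<le> ?I x \<omega>"
      using X_pos AE_space
    proof eventually_elim
      case (elim \<omega>)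
      then show ?case using mono[OF elim(1) assms(1)] xy by (cases "X \<omega> \<le> x") auto
    qed
  qed simp
qed

lemma excess_nonneg: "0 \<le> \<delta> x"
  unfolding tail_excess_def by (intro integral_nonneg_AE) auto

lemma moment_pos: "0 < m"
proof -
  have "m \<noteq> 0"
  proof
    assume "m = 0"
    then have "AE \<omega> in M. X \<omega> powr \<alpha> = 0"
      using moment by (subst (asm) integral_nonneg_eq_0_iff_AE) auto
    then have "AE \<omega> in M. False" using X_pos by eventually_elim auto
    then show False by simp
  qed
  moreover have "0 \<le> m" by (intro integral_nonneg_AE) auto
  ultimately show ?thesis by linarith
qed

lemma truncated_moment_tendsto_0:
  "((\<lambda>x. expectation (\<lambda>\<omega>. indicator {\<omega> \<in> space M. x < X \<omega>} \<omega> * X \<omega> powr \<alpha>)) \<longlongrightarrow> 0) at_top"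
proof -
  have "((\<lambda>x. expectation (\<lambda>\<omega>. indicator {\<omega> \<in> space M. x < X \<omega>} \<omega> * X \<omega> powr \<alpha>))
      \<longlongrightarrow> expectation (\<lambda>\<omega>. 0)) at_top"
  proof (rule integral_dominated_convergence_at_top[OF _ _ moment])
    show "AE \<omega> in M. ((\<lambda>x. indicator {\<omega> \<in> space M. x < X \<omega>} \<omega> * X \<omega> powr \<alpha>) \<longlongrightarrow> 0) at_top"
    proof (rule AE_I2)
      fix \<omega> assume "\<omega> \<in> space M"
      have "\<forall>\<^sub>F x in at_top. indicator {\<omega> \<in> space M. x < X \<omega>} \<omega> * X \<omega> powr \<alpha> = 0"
        using eventually_ge_at_top[of "X \<omega>"] by eventually_elim (auto simp: indicator_def)
      then show "((\<lambda>x. indicator {\<omega> \<in> space M. x < X \<omega>} \<omega> * X \<omega> powr \<alpha>) \<longlongrightarrow> 0) at_top"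
        by (rule tendsto_eventually)
    qed
    show "\<forall>\<^sub>F x in at_top. AE \<omega> in M. norm (indicator {\<omega> \<in> space M. x < X \<omega>} \<omega> * X \<omega> powr \<alpha>) \<le> X \<omega> powr \<alpha>"
      by (intro always_eventually allI AE_I2) (auto simp: indicator_def)
  qed measurable
  then show ?thesis by simp
qed

text \<open>
  Both functions lie below the expectation of \<open>X powr \<alpha>\<close> restricted to the event \<open>X > x\<close>.
\<close>

lemma
  shows weighted_survival_tendsto_0: "((\<lambda>x. x powr \<alpha> * (1 - F x)) \<longlongrightarrow> 0) at_top"
    and excess_tendsto_0: "(\<delta> \<longlongrightarrow> 0) at_top"
proof -
  let ?T = "\<lambda>x. expectation (\<lambda>\<omega>. indicator {\<omega> \<in> space M. x < X \<omega>} \<omega> * X \<omega> powr \<alpha>)"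
  have int: "integrable M (\<lambda>\<omega>. indicator {\<omega> \<in> space M. x < X \<omega>} \<omega> * X \<omega> powr \<alpha>)" for x
    using integrable_mult_indicator[OF _ moment, of "{\<omega> \<in> space M. x < X \<omega>}"] by simp
  have surv: "x powr \<alpha> * (1 - F x) \<le> ?T x" if "0 \<le> x" for x
    unfolding survival_eq integral_mult_right_zero[symmetric]
  proof (rule integral_mono_AE[OF _ int])
    show "AE \<omega> in M. x powr \<alpha> * indicator {\<omega> \<in> space M. x < X \<omega>} \<omega>
        \<le> indicator {\<omega> \<in> space M. x < X \<omega>} \<omega> * X \<omega> powr \<alpha>"
      using that exponent_pos by (intro AE_I2) (auto simp: indicator_def intro: powr_mono2)
    show "integrable M (\<lambda>\<omega>. x powr \<alpha> * indicator {\<omega> \<in> space M. x < X \<omega>} \<omega>)"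
      by (intro integrable_mult_right integrable_real_indicator) (auto simp: less_top[symmetric])
  qed
  have exc: "\<delta> x \<le> ?T x" if "0 \<le> x" for x
    unfolding tail_excess_def
  proof (rule integral_mono_AE[OF integrable_excess int])
    show "AE \<omega> in M. max 0 (X \<omega> powr \<alpha> - x powr \<alpha>)
        \<le> indicator {\<omega> \<in> space M. x < X \<omega>} \<omega> * X \<omega> powr \<alpha>"
      using X_pos AE_space
    proof eventually_elim
      case (elim \<omega>)
      have "X \<omega> \<le> x \<Longrightarrow> X \<omega> powr \<alpha> \<le> x powr \<alpha>"
        using elim exponent_pos by (intro powr_mono2) auto
      then show ?case using elim by (auto simp: indicator_def)
    qed
  qed
  have F1: "F x \<le> 1" for x using dist_fun_nonneg_range(2)[OF dist_fun_F] .
  show "((\<lambda>x. x powr \<alpha> * (1 - F x)) \<longlongrightarrow> 0) at_top"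
  proof (rule tendsto_sandwich[OF _ _ tendsto_const truncated_moment_tendsto_0])
    show "\<forall>\<^sub>F x in at_top. 0 \<le> x powr \<alpha> * (1 - F x)"
      using F1 by (intro always_eventually allI mult_nonneg_nonneg) auto
    show "\<forall>\<^sub>F x in at_top. x powr \<alpha> * (1 - F x) \<le> ?T x"
      using eventually_ge_at_top[of 0] by eventually_elim (rule surv)
  qed
  show "(\<delta> \<longlongrightarrow> 0) at_top"
  proof (rule tendsto_sandwich[OF _ _ tendsto_const truncated_moment_tendsto_0])
    show "\<forall>\<^sub>F x in at_top. 0 \<le> \<delta> x"
      by (simp add: excess_nonneg)
    show "\<forall>\<^sub>F x in at_top. \<delta> x \<le> ?T x"
      using eventually_ge_at_top[of 0] by eventually_elim (rule exc)
  qed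
qed

end

section \<open>Asymptotics of the excess for a tail in the class Gamma\<close>

text \<open>
  Along the orbit of \<open>x\<close> the value of \<open>V\<close> never decreases, yet it tends to 0 if the orbit tends
  to infinity. The positive nonincreasing function \<open>f\<close> ensures that it does: \<open>f\<close> contracts
  geometrically along the orbit, so it eventually falls below \<open>f B\<close> for any given \<open>B\<close>, and then
  the orbit has passed \<open>B\<close>. Below, \<open>f\<close> is the tail \<open>1 - F\<close>.
\<close>

lemma nonpos_if_increasing_along_orbit:
  fixes V f h :: "real \<Rightarrow> real"
  assumes h: "\<And>x. x \<ge> x0 \<Longrightarrow> x \<le> h x"
    and f_pos: "\<And>x. x \<ge> x0 \<Longrightarrow> 0 < f x"
    and f_anti: "\<And>x y. x \<ge> x0 \<Longrightarrow> x \<le> y \<Longrightarrow> f y \<le> f x"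
    and q: "0 \<le> q" "q < 1" "\<And>x. x \<ge> x0 \<Longrightarrow> f (h x) \<le> q * f x"
    and V: "\<And>x. x \<ge> x0 \<Longrightarrow> V x \<le> V (h x)" "(V \<longlongrightarrow> 0) at_top"
    and "x \<ge> x0"
  shows "V x \<le> 0"
proof -
  define X where "X n = (h ^^ n) x" for n
  have ge: "x0 \<le> X n" for n
    by (induction n) (use \<open>x \<ge> x0\<close> h in \<open>auto simp: X_def intro: order_trans\<close>)
  have decay: "f (X n) \<le> q ^ n * f x" for n
  proof (induction n)
    case (Suc n)
    have "f (X (Suc n)) \<le> q * f (X n)" using q(3)[OF ge[of n]] by (simp add: X_def)
    also have "\<dots> \<le> q * (q ^ n * f x)" using Suc q(1) by (intro mult_left_mono)
    finally show ?case by simp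
  qed (simp add: X_def)
  have "filterlim X at_top sequentially"
    unfolding filterlim_at_top
  proof
    fix B :: real
    define B' where "B' = max B x0"
    have "(\<lambda>n. q ^ n * f x) \<longlonglongrightarrow> 0 * f x"
      using q by (intro tendsto_mult tendsto_const LIMSEQ_realpow_zero) auto
    then have "\<forall>\<^sub>F n in sequentially. q ^ n * f x < f B'"
      using f_pos[of B'] by (intro order_tendstoD(2)) (auto simp: B'_def)
    then show "\<forall>\<^sub>F n in sequentially. B \<le> X n"
    proof eventually_elim
      case (elim n)
      then have "f (X n) < f B'" using decay[of n] by linarith
      then have "\<not> X n \<le> B'" using f_anti[OF ge[of n]] by force
      then show ?case by (simp add: B'_def)
    qed
  qed
  then have lim: "(\<lambda>n. V (X n)) \<longlonglongrightarrow> 0"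
    by (rule filterlim_compose[OF V(2)])
  have "V x \<le> V (X n)" for n
  proof (induction n)
    case (Suc n)
    then show ?case using V(1)[OF ge[of n]] by (simp add: X_def)
  qed (simp add: X_def)
  then show ?thesis by (intro LIMSEQ_le_const[OF lim]) auto
qed

text \<open>
  With \<open>u = g x / x\<close>, which tends to 0, the quotient is the difference quotient
  \<open>((1 + \<tau> * u) powr \<alpha> - 1) / u\<close>.
\<close>

lemma powr_increment_asymp:
  fixes g :: "real \<Rightarrow> real"
  assumes g_pos: "\<And>x. x > 0 \<Longrightarrow> g x > 0" and g: "((\<lambda>x. g x / x) \<longlongrightarrow> 0) at_top"
  shows "((\<lambda>x. ((x + \<tau> * g x) powr \<alpha> - x powr \<alpha>) / (x powr (\<alpha> - 1) * g x)) \<longlongrightarrow> \<alpha> * \<tau>) at_top"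
proof -
  have "((\<lambda>u::real. (1 + \<tau> * u) powr \<alpha>) has_real_derivative \<alpha> * \<tau>) (at 0)"
    by (auto intro!: derivative_eq_intros)
  then have "((\<lambda>u. ((1 + \<tau> * u) powr \<alpha> - 1) / u) \<longlongrightarrow> \<alpha> * \<tau>) (at 0)"
    by (simp add: has_field_derivative_iff)
  moreover have ev: "\<forall>\<^sub>F x in at_top. g x / x \<noteq> 0"
    using eventually_gt_at_top[of 0] by eventually_elim (auto dest: g_pos)
  then have "filterlim (\<lambda>x. g x / x) (at 0) at_top"
    using g by (simp add: filterlim_at)
  ultimately have "((\<lambda>x. ((1 + \<tau> * (g x / x)) powr \<alpha> - 1) / (g x / x)) \<longlongrightarrow> \<alpha> * \<tau>) at_top"
    by (rule filterlim_compose)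
  moreover have "((\<lambda>x. 1 + \<tau> * (g x / x)) \<longlongrightarrow> 1 + \<tau> * 0) at_top"
    by (intro tendsto_intros g)
  then have "\<forall>\<^sub>F x in at_top. 0 < 1 + \<tau> * (g x / x)"
    by (rule order_tendstoD(1)) simp
  with eventually_gt_at_top[of 0]
  have "\<forall>\<^sub>F x in at_top. ((1 + \<tau> * (g x / x)) powr \<alpha> - 1) / (g x / x)
      = ((x + \<tau> * g x) powr \<alpha> - x powr \<alpha>) / (x powr (\<alpha> - 1) * g x)"
  proof eventually_elim
    case (elim x)
    have "x + \<tau> * g x = x * (1 + \<tau> * (g x / x))"
      using elim by (simp add: distrib_left)
    then have "(x + \<tau> * g x) powr \<alpha> = (x * (1 + \<tau> * (g x / x))) powr \<alpha>"
      by (rule arg_cong)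
    also have "\<dots> = x powr \<alpha> * (1 + \<tau> * (g x / x)) powr \<alpha>"
      using elim by (subst powr_mult) auto
    finally have "((x + \<tau> * g x) powr \<alpha> - x powr \<alpha>) / (x powr (\<alpha> - 1) * g x)
        = (x powr \<alpha> * ((1 + \<tau> * (g x / x)) powr \<alpha> - 1)) / (x powr \<alpha> * (g x / x))"
      using elim by (simp add: powr_diff right_diff_distrib)
    then show ?case using elim by simp
  qed
  ultimately show ?thesis by (rule Lim_transform_eventually)
qed

lemma exp_slope_at_right_0:
  "((\<lambda>t::real. (1 - exp (- t)) / t) \<longlongrightarrow> 1) (at_right 0)"
proof -
  have "((\<lambda>t::real. - exp (- t)) has_real_derivative 1) (at 0)"
    by (auto intro!: derivative_eq_intros)
  then have "((\<lambda>t::real. (1 - exp (- t)) / t) \<longlongrightarrow> 1) (at 0)"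
    by (simp add: has_field_derivative_iff)
  then show ?thesis by (simp add: filterlim_at_split)
qed

context positive_moment_variable
begin

text \<open>
  For \<open>k > \<alpha>\<close> a step length \<open>t\<close> with \<open>\<alpha> * t < k * (1 - exp (-t))\<close> exists since
  \<open>(1 - exp (-t)) / t\<close> tends to 1 at 0. One step \<open>x \<mapsto> x + t * g x\<close> lowers \<open>\<delta>\<close> by at most about
  \<open>\<alpha> * t * A x\<close> and \<open>k * A\<close> by about \<open>k * (1 - exp (-t)) * A x\<close>, which is more; so
  \<open>\<delta> - k * A\<close> increases along orbits and \<open>nonpos_if_increasing_along_orbit\<close> applies. For
  \<open>k < \<alpha>\<close> the roles of \<open>\<delta>\<close> and \<open>k * A\<close> are exchanged, with \<open>\<alpha> * t * exp (-t)\<close> as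
  the lower bound for the decrease of \<open>\<delta>\<close>.
\<close>

lemma excess_asymp:
  assumes Gamma: "(\<lambda>x. 1 - F x) \<in> class_Gamma g"
  shows "((\<lambda>x. \<delta> x / (x powr (\<alpha> - 1) * g x * (1 - F x))) \<longlongrightarrow> \<alpha>) at_top"
proof -
  define A where "A x = x powr (\<alpha> - 1) * g x * (1 - F x)" for x
  have F_lt: "F x < 1" and g_pos: "0 < g x" if "0 < x" for x
    using Gamma that by (auto simp: class_Gamma_def pos_measurable_def)
  have A_pos: "0 < A x" if "0 < x" for x
    using F_lt[OF that] g_pos[OF that] that by (simp add: A_def)
  have gx: "((\<lambda>x. g x / x) \<longlongrightarrow> 0) at_top"
    and gg: "((\<lambda>x. g (x + t * g x) / g x) \<longlongrightarrow> 1) at_top"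
    and FF: "((\<lambda>x. (1 - F (x + t * g x)) / (1 - F x)) \<longlongrightarrow> exp (- t)) at_top" for t
    using Gamma by (auto simp: class_Gamma_def self_neglecting_def)
  \<comment> \<open>The orbit argument needs both \<open>\<delta>\<close> and \<open>A\<close> to vanish at infinity.\<close>
  have "((\<lambda>x. g x / x * (x powr \<alpha> * (1 - F x))) \<longlongrightarrow> 0 * 0) at_top"
    by (intro tendsto_mult gx weighted_survival_tendsto_0)
  moreover have "\<forall>\<^sub>F x in at_top. g x / x * (x powr \<alpha> * (1 - F x)) = A x"
    using eventually_gt_at_top[of 0] by eventually_elim (simp add: A_def powr_diff)
  ultimately have A_0: "(A \<longlongrightarrow> 0) at_top"
    by (auto dest: Lim_transform_eventually)
  have A_step: "((\<lambda>x. A (x + t * g x) / A x) \<longlongrightarrow> exp (- t)) at_top" for t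
  proof -
    have "((\<lambda>x. (1 + t * (g x / x)) powr (\<alpha> - 1) * (g (x + t * g x) / g x) * ((1 - F (x + t * g x)) / (1 - F x)))
        \<longlongrightarrow> (1 + t * 0) powr (\<alpha> - 1) * 1 * exp (- t)) at_top"
      by (intro tendsto_mult tendsto_powr tendsto_add tendsto_const gx gg FF) auto
    moreover have "((\<lambda>x. 1 + t * (g x / x)) \<longlongrightarrow> 1 + t * 0) at_top"
      by (intro tendsto_intros gx)
    then have "\<forall>\<^sub>F x in at_top. 0 < 1 + t * (g x / x)"
      by (rule order_tendstoD(1)) simp
    with eventually_gt_at_top[of 0]
    have "\<forall>\<^sub>F x in at_top. (1 + t * (g x / x)) powr (\<alpha> - 1) * (g (x + t * g x) / g x) * ((1 - F (x + t * g x)) / (1 - F x))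
        = A (x + t * g x) / A x"
    proof eventually_elim
      case (elim x)
      have "x + t * g x = x * (1 + t * (g x / x))"
        using elim by (simp add: distrib_left)
      then have "(x + t * g x) powr (\<alpha> - 1) = (x * (1 + t * (g x / x))) powr (\<alpha> - 1)"
        by (rule arg_cong)
      also have "\<dots> = x powr (\<alpha> - 1) * (1 + t * (g x / x)) powr (\<alpha> - 1)"
        using elim by (subst powr_mult) auto
      finally show ?case using elim by (simp add: A_def)
    qed
    ultimately show ?thesis by (auto dest: Lim_transform_eventually)
  qed
  have inc: "((\<lambda>x. (1 - F x) * ((x + t * g x) powr \<alpha> - x powr \<alpha>) / A x) \<longlongrightarrow> \<alpha> * t) at_top" for t
  proof (rule Lim_transform_eventually[OF powr_increment_asymp[OF g_pos gx]])
    show "\<forall>\<^sub>F x in at_top. ((x + t * g x) powr \<alpha> - x powr \<alpha>) / (x powr (\<alpha> - 1) * g x)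
        = (1 - F x) * ((x + t * g x) powr \<alpha> - x powr \<alpha>) / A x"
      using eventually_gt_at_top[of 0]
    proof eventually_elim
      case (elim x)
      then show ?case using F_lt[OF elim] by (simp add: A_def)
    qed
  qed
  have inc': "((\<lambda>x. (1 - F (x + t * g x)) * ((x + t * g x) powr \<alpha> - x powr \<alpha>) / A x)
      \<longlongrightarrow> \<alpha> * t * exp (- t)) at_top" for t
  proof (rule Lim_transform_eventually[OF tendsto_mult[OF inc FF]])
    show "\<forall>\<^sub>F x in at_top. (1 - F x) * ((x + t * g x) powr \<alpha> - x powr \<alpha>) / A x * ((1 - F (x + t * g x)) / (1 - F x))
        = (1 - F (x + t * g x)) * ((x + t * g x) powr \<alpha> - x powr \<alpha>) / A x"
      using eventually_gt_at_top[of 0]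
    proof eventually_elim
      case (elim x)
      then show ?case using F_lt[OF elim] by simp
    qed
  qed
  have orbit: "\<forall>\<^sub>F x in at_top. V x \<le> 0"
    if "0 < t" and V0: "(V \<longlongrightarrow> 0) at_top" and V: "\<forall>\<^sub>F x in at_top. V x \<le> V (x + t * g x)"
    for V :: "real \<Rightarrow> real" and t
  proof -
    obtain q where q: "exp (- t) < q" "q < 1"
      using \<open>0 < t\<close> dense[of "exp (- t)" 1] by auto
    have "0 < q" using q(1) exp_gt_zero[of "- t"] by linarith
    have "\<forall>\<^sub>F x in at_top. (1 - F (x + t * g x)) / (1 - F x) < q"
      using FF q(1) by (rule order_tendstoD(2))
    with V eventually_gt_at_top[of 0]
    have "\<forall>\<^sub>F x in at_top. V x \<le> V (x + t * g x) \<and> 0 < x \<and> 1 - F (x + t * g x) \<le> q * (1 - F x)"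
    proof eventually_elim
      case (elim x)
      then show ?case using F_lt[of x] by (simp add: field_simps)
    qed
    then obtain x0 where x0: "\<And>x. x \<ge> x0 \<Longrightarrow> V x \<le> V (x + t * g x) \<and> 0 < x \<and> 1 - F (x + t * g x) \<le> q * (1 - F x)"
      by (auto simp: eventually_at_top_linorder)
    have "V x \<le> 0" if "x \<ge> x0" for x
    proof (rule nonpos_if_increasing_along_orbit[where h="\<lambda>x. x + t * g x" and f="\<lambda>x. 1 - F x" and q=q and V=V])
      show "y \<le> y + t * g y" if "x0 \<le> y" for y
        using g_pos[of y] x0[OF that] \<open>0 < t\<close> by simp
      show "0 < 1 - F y" if "x0 \<le> y" for y using F_lt[of y] x0[OF that] by simp
      show "1 - F z \<le> 1 - F y" if "x0 \<le> y" "y \<le> z" for y z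
        using dist_fun_F that by (simp add: dist_fun_nonneg_def mono_def)
    qed (use x0 q \<open>0 < q\<close> V0 that in auto)
    then show ?thesis by (auto simp: eventually_at_top_linorder)
  qed
  have step_bound: "P \<le> k * (a - b)" if "0 < a" "P / a - k * (1 - b / a) < 0" for P a b k :: real
  proof -
    have "P / a - k * (1 - b / a) = (P - k * (a - b)) / a"
      using \<open>0 < a\<close> by (simp add: diff_divide_distrib right_diff_distrib)
    then show ?thesis using that by (simp add: divide_less_0_iff)
  qed
  have upper: "\<forall>\<^sub>F x in at_top. \<delta> x \<le> k * A x" if "\<alpha> < k" for k
  proof -
    have "((\<lambda>t. \<alpha> - k * ((1 - exp (- t)) / t)) \<longlongrightarrow> \<alpha> - k * 1) (at_right 0)"
      by (intro tendsto_intros exp_slope_at_right_0)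
    then have "\<forall>\<^sub>F t in at_right 0. \<alpha> - k * ((1 - exp (- t)) / t) < 0"
      using that by (intro order_tendstoD(2)) auto
    then have "\<forall>\<^sub>F t in at_right 0. \<alpha> - k * ((1 - exp (- t)) / t) < 0 \<and> 0 < t"
      using eventually_at_right_less by (rule eventually_conj)
    then obtain t where t: "\<alpha> - k * ((1 - exp (- t)) / t) < 0" "0 < t"
      using eventually_happens'[OF trivial_limit_at_right_real] by blast
    have neg: "\<alpha> * t - k * (1 - exp (- t)) < 0"
      using t by (simp add: field_simps)
    have "((\<lambda>x. (1 - F x) * ((x + t * g x) powr \<alpha> - x powr \<alpha>) / A x - k * (1 - A (x + t * g x) / A x))
        \<longlongrightarrow> \<alpha> * t - k * (1 - exp (- t))) at_top"
      by (intro tendsto_diff tendsto_mult tendsto_const inc A_step)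
    then have "\<forall>\<^sub>F x in at_top. (1 - F x) * ((x + t * g x) powr \<alpha> - x powr \<alpha>) / A x - k * (1 - A (x + t * g x) / A x) < 0"
      using neg by (rule order_tendstoD(2))
    with eventually_gt_at_top[of 0]
    have "\<forall>\<^sub>F x in at_top. \<delta> x - k * A x \<le> \<delta> (x + t * g x) - k * A (x + t * g x)"
    proof eventually_elim
      case (elim x)
      have "\<delta> x - \<delta> (x + t * g x) \<le> (1 - F x) * ((x + t * g x) powr \<alpha> - x powr \<alpha>)"
        using g_pos[OF elim(1)] t(2) elim(1) by (intro excess_increment_upper) auto
      also have "\<dots> \<le> k * (A x - A (x + t * g x))"
        using step_bound[OF A_pos[OF elim(1)] elim(2)] by simp
      finally show ?case by (simp add: algebra_simps)
    qed
    moreover have "((\<lambda>x. \<delta> x - k * A x) \<longlongrightarrow> 0 - k * 0) at_top"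
      by (intro tendsto_intros excess_tendsto_0 A_0)
    ultimately have "\<forall>\<^sub>F x in at_top. \<delta> x - k * A x \<le> 0"
      using t(2) by (intro orbit) simp_all
    then show ?thesis by simp
  qed
  have lower: "\<forall>\<^sub>F x in at_top. k * A x \<le> \<delta> x" if "k < \<alpha>" for k
  proof -
    have "((\<lambda>t. k * ((1 - exp (- t)) / t) - \<alpha> * exp (- t)) \<longlongrightarrow> k * 1 - \<alpha> * exp (- 0)) (at_right 0)"
      by (intro tendsto_intros exp_slope_at_right_0)
    then have "\<forall>\<^sub>F t in at_right 0. k * ((1 - exp (- t)) / t) - \<alpha> * exp (- t) < 0"
      using that by (intro order_tendstoD(2)) auto
    then have "\<forall>\<^sub>F t in at_right 0. k * ((1 - exp (- t)) / t) - \<alpha> * exp (- t) < 0 \<and> 0 < t"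
      using eventually_at_right_less by (rule eventually_conj)
    then obtain t where t: "k * ((1 - exp (- t)) / t) - \<alpha> * exp (- t) < 0" "0 < t"
      using eventually_happens'[OF trivial_limit_at_right_real] by blast
    have neg: "k * (1 - exp (- t)) - \<alpha> * t * exp (- t) < 0"
      using t by (simp add: field_simps)
    have "((\<lambda>x. k * (1 - A (x + t * g x) / A x) - (1 - F (x + t * g x)) * ((x + t * g x) powr \<alpha> - x powr \<alpha>) / A x)
        \<longlongrightarrow> k * (1 - exp (- t)) - \<alpha> * t * exp (- t)) at_top"
      by (intro tendsto_diff tendsto_mult[OF tendsto_const] tendsto_const inc' A_step)
    then have "\<forall>\<^sub>F x in at_top. k * (1 - A (x + t * g x) / A x) - (1 - F (x + t * g x)) * ((x + t * g x) powr \<alpha> - x powr \<alpha>) / A x < 0"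
      using neg by (rule order_tendstoD(2))
    with eventually_gt_at_top[of 0]
    have "\<forall>\<^sub>F x in at_top. k * A x - \<delta> x \<le> k * A (x + t * g x) - \<delta> (x + t * g x)"
    proof eventually_elim
      case (elim x)
      have "k * (A x - A (x + t * g x)) \<le> (1 - F (x + t * g x)) * ((x + t * g x) powr \<alpha> - x powr \<alpha>)"
        using step_bound[OF A_pos[OF elim(1)], of "- ((1 - F (x + t * g x)) * ((x + t * g x) powr \<alpha> - x powr \<alpha>))" "- k"]
          elim(2) by simp
      also have "\<dots> \<le> \<delta> x - \<delta> (x + t * g x)"
        using g_pos[OF elim(1)] t(2) elim(1) by (intro excess_increment_lower) auto
      finally show ?case by (simp add: algebra_simps)
    qed
    moreover have "((\<lambda>x. k * A x - \<delta> x) \<longlongrightarrow> k * 0 - 0) at_top"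
      by (intro tendsto_intros excess_tendsto_0 A_0)
    ultimately have "\<forall>\<^sub>F x in at_top. k * A x - \<delta> x \<le> 0"
      using t(2) by (intro orbit) simp_all
    then show ?thesis by simp
  qed
  have "((\<lambda>x. \<delta> x / A x) \<longlongrightarrow> \<alpha>) at_top"
  proof (rule order_tendstoI)
    fix a :: real assume "a < \<alpha>"
    then obtain k where k: "a < k" "k < \<alpha>" using dense by blast
    from lower[OF k(2)] eventually_gt_at_top[of 0]
    show "\<forall>\<^sub>F x in at_top. a < \<delta> x / A x"
    proof eventually_elim
      case (elim x)
      then have "k \<le> \<delta> x / A x" using A_pos by (simp add: pos_le_divide_eq)
      then show ?case using k by simp
    qed
  next
    fix a :: real assume "\<alpha> < a"
    then obtain k where k: "\<alpha> < k" "k < a" using dense by blast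
    from upper[OF k(1)] eventually_gt_at_top[of 0]
    show "\<forall>\<^sub>F x in at_top. \<delta> x / A x < a"
    proof eventually_elim
      case (elim x)
      then have "\<delta> x / A x \<le> k" using A_pos by (simp add: pos_divide_le_eq)
      then show ?case using k by simp
    qed
  qed
  then show ?thesis by (simp add: A_def)
qed

section \<open>Asymptotics of the renewal function\<close>

lemma scaled_renewal_eq:
  assumes "0 < x" "F x < 1"
  shows "m - \<delta> x > 0"
    and "x powr (- \<alpha>) * kendall_renewal \<alpha> F x
      = 2 / (m - \<delta> x) - x powr \<alpha> * (1 - F x) / (m - \<delta> x)^2"
proof -
  define w where "w = 1 - williamson \<alpha> F x"
  have w: "0 < w"
    using williamson_le[OF exponent_pos dist_fun_F, of x] assms by (simp add: w_def)
  have \<mu>: "m - \<delta> x = x powr \<alpha> * w"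
    using scaled_williamson_defect[of x] assms by (simp add: w_def)
  show "m - \<delta> x > 0" unfolding \<mu> using w assms by simp
  show "x powr (- \<alpha>) * kendall_renewal \<alpha> F x
      = 2 / (m - \<delta> x) - x powr \<alpha> * (1 - F x) / (m - \<delta> x)^2"
    unfolding kendall_renewal_eq[OF exponent_pos dist_fun_F less_imp_le[OF assms(1)] assms(2)]
      \<mu> w_def[symmetric]
    using w assms by (simp add: powr_minus divide_simps power2_eq_square)
qed

end

theorem theorem7:
  fixes \<alpha> :: real and M :: "'a measure" and X :: "'a \<Rightarrow> real"
    and F R g :: "real \<Rightarrow> real" and m :: real
  assumes "\<alpha> > 0"
    and "prob_space M"
    and "X \<in> borel_measurable M"
    and "AE \<omega> in M. X \<omega> > 0"
    and F: "F = cdf (distr M borel X)"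
    and "continuous_on UNIV F"
    and "integrable M (\<lambda>\<omega>. X \<omega> powr \<alpha>)"
    and m: "m = prob_space.expectation M (\<lambda>\<omega>. X \<omega> powr \<alpha>)"
    and R: "R = kendall_renewal \<alpha> F"
    and "(\<lambda>x. 1 - F x) \<in> class_Gamma g"
  shows "((\<lambda>x. 1 / (x powr \<alpha> * (1 - F x)) * (2 / m - x powr (- \<alpha>) * R x))
            \<longlongrightarrow> 1 / m\<^sup>2) at_top
       \<and> (\<lambda>x. 1 / (x powr \<alpha> * (1 - F x)) * (x powr (- \<alpha>) * R x - 2 / m) + 1 / m\<^sup>2)
            \<sim>[at_top] (\<lambda>x. g x / x * (2 * \<alpha> / m\<^sup>2))"
proof -
  interpret X: positive_moment_variable M X \<alpha>
    using assms by (simp add: positive_moment_variable_def positive_moment_variable_axioms_def)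
  define Q where "Q x = x powr \<alpha> * (1 - F x)" for x
  define \<mu> where "\<mu> x = m - X.\<delta> x" for x
  define r where "r x = X.\<delta> x / (x powr (\<alpha> - 1) * g x * (1 - F x))" for x
  have m_pos: "0 < m" using X.moment_pos by (simp add: m)
  have F_lt: "F x < 1" and g_pos: "0 < g x" if "0 < x" for x
    using assms(10) that by (auto simp: class_Gamma_def pos_measurable_def)
  have gx: "((\<lambda>x. g x / x) \<longlongrightarrow> 0) at_top"
    using assms(10) by (simp add: class_Gamma_def)
  have Q_0: "(Q \<longlongrightarrow> 0) at_top"
    using X.weighted_survival_tendsto_0 by (simp add: Q_def[abs_def] F)
  have \<mu>_lim: "(\<mu> \<longlongrightarrow> m) at_top"
    using tendsto_diff[OF tendsto_const X.excess_tendsto_0, of m] by (simp add: \<mu>_def[abs_def])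
  have r_lim: "(r \<longlongrightarrow> \<alpha>) at_top"
    using X.excess_asymp assms(10) by (simp add: r_def[abs_def] F)
  have Q_pos: "0 < Q x" if "0 < x" for x using F_lt[OF that] that by (simp add: Q_def)
  have \<mu>_pos: "0 < \<mu> x" if "0 < x" for x
    using X.scaled_renewal_eq(1)[OF that] F_lt[OF that] by (simp add: \<mu>_def m F)
  have R_eq: "x powr (- \<alpha>) * R x = 2 / \<mu> x - Q x / (\<mu> x)^2" if "0 < x" for x
    using X.scaled_renewal_eq(2)[OF that] F_lt[OF that] by (simp add: \<mu>_def Q_def R m F)
  \<comment> \<open>Written this way, all limits below reduce to those of \<open>r\<close>, \<open>g x / x\<close>, \<open>Q\<close> and \<open>\<mu>\<close>.\<close>
  have excess: "m - \<mu> x = r x * (g x / x) * Q x" if "0 < x" for x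
    using that g_pos[OF that] F_lt[OF that] by (simp add: \<mu>_def r_def Q_def powr_diff)
  have expand: "1 / Q x * (2 / m - x powr (- \<alpha>) * R x)
      = 1 / (\<mu> x)^2 - 2 * (r x * (g x / x)) / (m * \<mu> x)" if "0 < x" for x
  proof -
    have "2 / m - 2 / \<mu> x = - (2 * (m - \<mu> x) / (m * \<mu> x))"
      using m_pos \<mu>_pos[OF that] by (simp add: field_simps)
    then have "2 / m - x powr (- \<alpha>) * R x
        = Q x * (1 / (\<mu> x)^2 - 2 * (r x * (g x / x)) / (m * \<mu> x))"
      unfolding R_eq[OF that] excess[OF that] by (simp add: algebra_simps)
    then show ?thesis using Q_pos[OF that] by simp
  qed
  have "((\<lambda>x. 1 / (\<mu> x)^2 - 2 * (r x * (g x / x)) / (m * \<mu> x))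
      \<longlongrightarrow> 1 / m^2 - 2 * (\<alpha> * 0) / (m * m)) at_top"
    using m_pos by (intro tendsto_intros \<mu>_lim r_lim gx) auto
  moreover have "\<forall>\<^sub>F x in at_top. 1 / (\<mu> x)^2 - 2 * (r x * (g x / x)) / (m * \<mu> x)
      = 1 / Q x * (2 / m - x powr (- \<alpha>) * R x)"
    using eventually_gt_at_top[of 0] by eventually_elim (simp only: expand)
  ultimately have first: "((\<lambda>x. 1 / Q x * (2 / m - x powr (- \<alpha>) * R x)) \<longlongrightarrow> 1 / m^2) at_top"
    by (auto dest: Lim_transform_eventually)
  have "((\<lambda>x. (2 * r x / (m * \<mu> x) - r x * Q x * (\<mu> x + m) / (m^2 * (\<mu> x)^2)) / (2 * \<alpha> / m^2))
      \<longlongrightarrow> (2 * \<alpha> / (m * m) - \<alpha> * 0 * (m + m) / (m^2 * m^2)) / (2 * \<alpha> / m^2)) at_top"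
    using m_pos \<open>\<alpha> > 0\<close> by (intro tendsto_intros \<mu>_lim r_lim Q_0) auto
  moreover have "(2 * \<alpha> / (m * m) - \<alpha> * 0 * (m + m) / (m^2 * m^2)) / (2 * \<alpha> / m^2) = 1"
    using m_pos \<open>\<alpha> > 0\<close> by (simp add: power2_eq_square)
  ultimately have ratio: "((\<lambda>x. (2 * r x / (m * \<mu> x) - r x * Q x * (\<mu> x + m) / (m^2 * (\<mu> x)^2)) / (2 * \<alpha> / m^2))
      \<longlongrightarrow> 1) at_top"
    by simp
  \<comment> \<open>The term with \<open>Q\<close> stems from \<open>1 / m^2 - 1 / (\<mu> x)^2\<close>, which is of the order of the excess and so
    smaller than \<open>g x / x\<close> by a factor \<open>Q x\<close>.\<close>
  have second: "(\<lambda>x. 1 / Q x * (x powr (- \<alpha>) * R x - 2 / m) + 1 / m^2) \<sim>[at_top] (\<lambda>x. g x / x * (2 * \<alpha> / m^2))"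
  proof (rule asymp_equivI', rule Lim_transform_eventually[OF ratio])
    show "\<forall>\<^sub>F x in at_top. (2 * r x / (m * \<mu> x) - r x * Q x * (\<mu> x + m) / (m^2 * (\<mu> x)^2)) / (2 * \<alpha> / m^2)
        = (1 / Q x * (x powr (- \<alpha>) * R x - 2 / m) + 1 / m^2) / (g x / x * (2 * \<alpha> / m^2))"
      using eventually_gt_at_top[of 0]
    proof eventually_elim
      case (elim x)
      define e where "e = g x / x"
      have e: "0 < e" using g_pos[OF elim] elim by (simp add: e_def)
      have ex: "m - \<mu> x = r x * e * Q x" using excess[OF elim] by (simp add: e_def)
      have sq: "1 / m^2 - 1 / (\<mu> x)^2 = - ((m - \<mu> x) * (\<mu> x + m) / (m^2 * (\<mu> x)^2))"
        using m_pos \<mu>_pos[OF elim] by (simp add: field_simps power2_eq_square)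
      have "1 / Q x * (x powr (- \<alpha>) * R x - 2 / m) + 1 / m^2
          = - (1 / Q x * (2 / m - x powr (- \<alpha>) * R x)) + 1 / m^2"
        by (simp add: algebra_simps)
      also have "\<dots> = 2 * (r x * e) / (m * \<mu> x) + (1 / m^2 - 1 / (\<mu> x)^2)"
        unfolding expand[OF elim] by (simp add: e_def)
      also have "\<dots> = e * (2 * r x / (m * \<mu> x) - r x * Q x * (\<mu> x + m) / (m^2 * (\<mu> x)^2))"
        unfolding sq ex by (simp add: algebra_simps)
      finally show ?case using e by (simp add: e_def[symmetric])
    qed
  qed
  show ?thesis using first second by (simp add: Q_def)
qed

end
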